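(* Let $n\ge1$ be an integer, $s\in\mathbb{C}\setminus\{0\}$, and let $Z=(T^*\mathbb{CP}^n)_\lambda$ be the twisted cotangent bundle with parameter $s$, with complex structure $I$ and function $\tau\in C^\infty(Z)$ as defined in the context. Let $f\in C^\infty(\mathbb{R})$ be any real-valued function such that $\omega_I=\mathrm{d}\big(\tfrac{\sqrt{-1}}{4}f(\tau)(\overline{\partial}\tau-\partial\tau)\big)$ satisfies $\omega_I(v,Iv)>0$ for all nonzero real tangent vectors $v$. Let $A_\alpha=(g_{i\bar j})_{i,j=1,\dots,2n}$ be the associated matrix of components on $\pi_\lambda^{-1}(U_\alpha)$, and let $J=(\omega_I^\flat)^{-1}\circ\omega_K^\flat$, $K=(\omega_J^\flat)^{-1}\circ\omega_I^\flat$ be the endomorphisms of the (complexified) tangent bundle of $Z$ defined in the context. Then, on each $\pi_\lambda^{-1}(U_\alpha)$, one has $J^2=K^2=-1$ if and only if $${}^tA_\alpha\,S\,A_\alpha=S,\qquad S=\begin{bmatrix}0&1_n\\-1_n&0\end{bmatrix}.$$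
   Context: Indices of $\mathbb{C}^{n+1}$ run over $0,1,\dots,n$, and $e_n={}^t(0,\dots,0,1)$. Put $G^c=\mathrm{SL}_{n+1}(\mathbb{C})$, and let $Q\subset G^c$ be the subgroup of block lower triangular matrices $\left[\begin{smallmatrix} a&0\\ c&d\end{smallmatrix}\right]$ ($a\in \mathrm{GL}_n(\mathbb{C})$, $c$ a row vector, $d\in\mathbb{C}^\times$), and $L\subset Q$ the subgroup of block diagonal ones ($c=0$). $G^c/Q\cong\mathbb{CP}^n$ by $gQ\mapsto[g e_n]$. For a column vector $z\in\mathbb{C}^n$ and a row vector $w\in(\mathbb{C}^n)^*$ put $u_z=\left[\begin{smallmatrix}1_n&z\\0&1\end{smallmatrix}\right]$ and $u^-_w=\left[\begin{smallmatrix}1_n&0\\ w&1\end{smallmatrix}\right]$. For $\alpha=0,\dots,n$, let $\sigma_\alpha\in \mathrm{SU}(n+1)$ be a fixed signed permutation matrix of determinant one corresponding to the cyclic permutation $(\alpha,\alpha+1,\dots,n)$ (so $\sigma_\alpha e_n=\pm e_\alpha$), let $U_\alpha=\{[\zeta_0:\dots:\zeta_n]:\zeta_\alpha\ne0\}$, and let $\varphi_\alpha:U_\alpha\to\mathbb{C}^n$ be the holomorphic chart sending $[\sigma_\alpha u_{z}e_n]$ to $z=z_\alpha$. Let $\lambda$ be the linear functional on $\mathfrak{sl}_{n+1}(\mathbb{C})$ given by $\langle\lambda,X\rangle=\operatorname{tr}(\lambda^\vee X)$ with $\lambda^\vee=\frac{s}{n+1}\left[\begin{smallmatrix}1_n&0\\0&-n\end{smallmatrix}\right]$;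 thus $\langle\lambda,\left[\begin{smallmatrix}a&0\\ c&d\end{smallmatrix}\right]\rangle=-sd$. Twisted cotangent bundle: $Z=(T^*\mathbb{CP}^n)_\lambda:=\bigsqcup_{\alpha=0}^n T^*U_\alpha/\sim$, where a point of the holomorphic cotangent bundle $T^*U_\alpha$ is written $\xi_\alpha\,\mathrm{d}z_\alpha=\sum_i\xi_{\alpha,i}\,\mathrm{d}z_{\alpha,i}$ ($z_\alpha$ a column vector, $\xi_\alpha$ a row vector), and over $U_\alpha\cap U_\beta$ the point $\xi_\beta\,\mathrm{d}z_\beta$ is equivalent to $\xi_\alpha\,\mathrm{d}z_\alpha$ iff $z_\beta=(\varphi_\beta\circ\varphi_\alpha^{-1})(z_\alpha)$ and $\xi_\beta\,\mathrm{d}z_\beta=\xi_\alpha\,\mathrm{d}z_\alpha-\langle\lambda,\mathrm{d}t_{\alpha\beta}\,t_{\alpha\beta}^{-1}\rangle$. Here $t_{\alpha\beta}\in L$ is the unique element with $\sigma_\beta u_{z_\beta}u^-_{w_\beta}=\sigma_\alpha u_{z_\alpha}u^-_{w_\alpha}t_{\alpha\beta}$, where $\xi_\alpha=-sw_\alpha$, $\xi_\beta=-sw_\beta$. The projection is $\pi_\lambda:Z\to\mathbb{CP}^n$, so $\pi_\lambda^{-1}(U_\alpha)=T^*U_\alpha$ has holomorphic coordinates $(z,\xi)=(z_1,\dots,z_n,\xi_1,\dots,\xi_n)\in\mathbb{C}^{2n}$ (index $\alpha$ suppressed). $Z$ is a complex manifold of complex dimension $2n$, with complex structure $I$. The map $\mu_+:Z\to\mathfrak{sl}_{n+1}(\mathbb{C})$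 is given on $\pi_\lambda^{-1}(U_\alpha)$ by $\mu_+(z,\xi)=h\lambda^\vee h^{-1}$ with $h=\sigma_\alpha u_zu^-_w$, $\xi=-sw$ (it is well defined on $Z$). The function $\tau:=\operatorname{tr}(\mu_+\mu_+^* )+\frac{|s|^2}{n+1}$ on $Z$ (with $*$ the conjugate transpose) is given on every $\pi_\lambda^{-1}(U_\alpha)$ by $\tau=(\|z\|^2+1)(\|\xi\|^2+|s-\xi z|^2)$, where $\|z\|^2=z^*z$, $\|\xi\|^2=\xi\xi^*$. Convention: $z_{n+i}:=\xi_i$ for $i=1,\dots,n$. The components $g_{i\bar j}$ ($i,j=1,\dots,2n$) on $\pi_\lambda^{-1}(U_\alpha)$ are defined by $\omega_I=\frac{\sqrt{-1}}{2}\sum_{i,j=1}^{2n}g_{i\bar j}\,\mathrm{d}z_i\wedge\mathrm{d}\bar z_j$; equivalently $g_{i\bar j}=f(\tau)\frac{\partial^2\tau}{\partial z_i\partial\bar z_j}+f'(\tau)\frac{\partial\tau}{\partial z_i}\frac{\partial\tau}{\partial\bar z_j}$. Symplectic forms: $Z$ carries the holomorphic symplectic form $\omega_+$ given on each $\pi_\lambda^{-1}(U_\alpha)$ by $\omega_+=\sum_{i=1}^n\mathrm{d}z_i\wedge\mathrm{d}\xi_i$. Write $\omega_+=\omega_J+\sqrt{-1}\,\omega_K$ with $\omega_J,\omega_K$ real $2$-forms. For a non-degenerate bilinear form $\omega$ on $T_pZ$ let $\omega^\flat:T_pZ\to T_p^*Z$ be the isomorphism $\omega^\flat(v)=\omega(v,\cdot)$.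 The endomorphisms $J,K$ are extended complex-linearly to $TZ\otimes\mathbb{C}$. *)

theory Defs
  imports "HOL-Analysis.Analysis" "HOL-Combinatorics.Cycles"
begin

hide_const (open) Transposition.transpose

section \<open>Block matrices of size $n+1$\<close>

text \<open>
  The linearly ordered finite type \<open>'n\<close> indexes the coordinates \<open>0, \<dots>, n-1\<close>. The index type of
  $\mathbb{C}^{n+1}$ is \<open>'n option\<close>: \<open>Some i\<close> stands for \<open>i\<close> and \<open>None\<close> for the last index \<open>n\<close>.
  Row and column vectors both have type \<open>complex ^ 'n\<close>.
\<close>

type_synonym 'n mat1 = "complex ^ ('n option) ^ ('n option)"

definition block ::
  "complex ^ 'n ^ 'n \<Rightarrow> complex ^ 'n \<Rightarrow> complex ^ 'n \<Rightarrow> complex \<Rightarrow> ('n::finite) mat1" where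
  "block a b c d = (\<chi> i j. case (i, j) of
      (Some k, Some l) \<Rightarrow> a $ k $ l
    | (Some k, None) \<Rightarrow> b $ k
    | (None, Some l) \<Rightarrow> c $ l
    | (None, None) \<Rightarrow> d)"

definition e_last :: "complex ^ ('n::finite option)" where
  "e_last = axis None 1"

definition u_plus :: "complex ^ 'n \<Rightarrow> ('n::finite) mat1" where
  "u_plus z = block (mat 1) z 0 1"

definition u_minus :: "complex ^ 'n \<Rightarrow> ('n::finite) mat1" where
  "u_minus w = block (mat 1) 0 w 1"

definition SL :: "('n::finite) mat1 set" where
  "SL = {g. det g = 1}"

definition Levi :: "('n::finite) mat1 set" where
  "Levi = {g \<in> SL. \<exists>a d. g = block a 0 0 d}"

definition conj_transpose :: "complex ^ 'm ^ 'm \<Rightarrow> complex ^ 'm ^ 'm" where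
  "conj_transpose M = (\<chi> i j. cnj (M $ j $ i))"

text \<open>The cyclic permutation $(\alpha, \alpha+1, \dots, n)$; in particular it maps \<open>n\<close> to $\alpha$.\<close>

fun cycle_list :: "('n::{finite,linorder}) option \<Rightarrow> 'n option list" where
  "cycle_list None = [None]"
| "cycle_list (Some a) = map Some (sorted_list_of_set {a..}) @ [None]"

definition signed_perm_matrix :: "('m \<Rightarrow> 'm) \<Rightarrow> complex ^ 'm ^ 'm \<Rightarrow> bool" where
  "signed_perm_matrix \<pi> M \<longleftrightarrow>
     (\<exists>\<epsilon>. (\<forall>j. \<epsilon> j \<in> {1, -1}) \<and> M = (\<chi> i j. if i = \<pi> j then \<epsilon> j else 0))"

text \<open>The matrices $\sigma_\alpha$ are an arbitrary admissible choice. They are real orthogonal of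
  determinant one, hence in $\mathrm{SU}(n+1)$.\<close>

definition admissible_sigma :: "('n::{finite,linorder} option \<Rightarrow> 'n mat1) \<Rightarrow> bool" where
  "admissible_sigma \<sigma> \<longleftrightarrow>
     (\<forall>\<alpha>. signed_perm_matrix (cycle_of_list (cycle_list \<alpha>)) (\<sigma> \<alpha>) \<and> \<sigma> \<alpha> \<in> SL)"


section \<open>Projective space and its charts\<close>

definition proj_point :: "complex ^ 'm \<Rightarrow> (complex ^ 'm) set" where
  "proj_point \<zeta> = {c *s \<zeta> |c. c \<noteq> 0}"

definition U_chart :: "'m \<Rightarrow> (complex ^ 'm) set set" where
  "U_chart \<alpha> = {proj_point \<zeta> |\<zeta>. \<zeta> $ \<alpha> \<noteq> 0}"

definition cp_param ::
  "('n option \<Rightarrow> 'n mat1) \<Rightarrow> 'n option \<Rightarrow> complex ^ 'n \<Rightarrow> (complex ^ ('n::finite option)) set" where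
  "cp_param \<sigma> \<alpha> z = proj_point ((\<sigma> \<alpha> ** u_plus z) *v e_last)"

definition cp_chart ::
  "('n option \<Rightarrow> 'n mat1) \<Rightarrow> 'n option \<Rightarrow> (complex ^ ('n::finite option)) set \<Rightarrow> complex ^ 'n" where
  "cp_chart \<sigma> \<alpha> = inv (cp_param \<sigma> \<alpha>)"

definition cp_transition ::
  "('n option \<Rightarrow> 'n mat1) \<Rightarrow> 'n option \<Rightarrow> 'n option \<Rightarrow> complex ^ 'n \<Rightarrow> complex ^ ('n::finite)" where
  "cp_transition \<sigma> \<alpha> \<beta> z = cp_chart \<sigma> \<beta> (cp_param \<sigma> \<alpha> z)"


section \<open>The twisted cotangent bundle\<close>

text \<open>
  A point $\xi\,\mathrm{d}z$ of $T^*U_\alpha \cong \mathbb{C}^{2n}$ is a vector indexed by \<open>'n + 'n\<close>,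
  with \<open>Inl i\<close> the index of $z_i$ and \<open>Inr i\<close> that of $z_{n+i} = \xi_i$. Tangent vectors of
  $T^*U_\alpha$ (as a real manifold) are elements of the same space, read in the coordinates
  $(z, \xi)$.
\<close>

type_synonym 'n cvec = "complex ^ ('n + 'n)"

definition z_part :: "('n::finite) cvec \<Rightarrow> complex ^ 'n" where
  "z_part p = (\<chi> i. p $ Inl i)"

definition xi_part :: "('n::finite) cvec \<Rightarrow> complex ^ 'n" where
  "xi_part p = (\<chi> i. p $ Inr i)"

text \<open>The row vector \<open>w\<close> with $\xi = -sw$.\<close>

definition w_part :: "complex \<Rightarrow> 'n cvec \<Rightarrow> complex ^ ('n::finite)" where
  "w_part s p = (- 1 / s) *s xi_part p"

definition h_matrix ::
  "('n option \<Rightarrow> 'n mat1) \<Rightarrow> complex \<Rightarrow> 'n option \<Rightarrow> 'n cvec \<Rightarrow> ('n::finite) mat1" where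
  "h_matrix \<sigma> s \<alpha> p = \<sigma> \<alpha> ** u_plus (z_part p) ** u_minus (w_part s p)"

definition lambda_dual :: "complex \<Rightarrow> ('n::finite) mat1" where
  "lambda_dual s = block (mat (s / (of_nat CARD('n) + 1))) 0 0
                     (- of_nat CARD('n) * s / (of_nat CARD('n) + 1))"

definition lambda_pair :: "complex \<Rightarrow> ('n::finite) mat1 \<Rightarrow> complex" where
  "lambda_pair s X = trace (lambda_dual s ** X)"

text \<open>$t_{\alpha\beta}$, as a function on the part of $T^*U_\alpha$ over $U_\alpha \cap U_\beta$.
  The row vector $w_\beta$ is determined along with $t_{\alpha\beta}$ by the factorisation.\<close>

definition t_cocycle ::
  "('n option \<Rightarrow> 'n mat1) \<Rightarrow> complex \<Rightarrow> 'n option \<Rightarrow> 'n option \<Rightarrow> 'n cvec \<Rightarrow> ('n::finite) mat1" where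
  "t_cocycle \<sigma> s \<alpha> \<beta> p = (THE t. t \<in> Levi \<and>
     (\<exists>w. \<sigma> \<beta> ** u_plus (cp_transition \<sigma> \<alpha> \<beta> (z_part p)) ** u_minus w = h_matrix \<sigma> s \<alpha> p ** t))"

text \<open>The identity of one-forms
  $\xi_\beta\,\mathrm{d}z_\beta = \xi_\alpha\,\mathrm{d}z_\alpha
    - \langle\lambda, \mathrm{d}t_{\alpha\beta}\,t_{\alpha\beta}^{-1}\rangle$
  is evaluated on every tangent vector \<open>v\<close> at the point \<open>p\<close> of $T^*U_\alpha$.\<close>

definition glue ::
  "('n option \<Rightarrow> 'n mat1) \<Rightarrow> complex \<Rightarrow>
     (('n option \<times> 'n cvec) \<times> ('n::finite option \<times> 'n cvec)) set" where
  "glue \<sigma> s = {((\<alpha>, p), (\<beta>, q)).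
     cp_param \<sigma> \<alpha> (z_part p) \<in> U_chart \<beta> \<and>
     z_part q = cp_transition \<sigma> \<alpha> \<beta> (z_part p) \<and>
     (\<forall>v. (\<Sum>i\<in>UNIV. xi_part q $ i *
              frechet_derivative (cp_transition \<sigma> \<alpha> \<beta>) (at (z_part p)) (z_part v) $ i)
        = (\<Sum>i\<in>UNIV. xi_part p $ i * z_part v $ i)
          - lambda_pair s (frechet_derivative (t_cocycle \<sigma> s \<alpha> \<beta>) (at p) v
                             ** matrix_inv (t_cocycle \<sigma> s \<alpha> \<beta> p)))}"

type_synonym 'n zpoint = "('n option \<times> 'n cvec) set"

definition twisted_cotangent ::
  "('n option \<Rightarrow> 'n mat1) \<Rightarrow> complex \<Rightarrow> ('n::finite) zpoint set" where
  "twisted_cotangent \<sigma> s = UNIV // glue \<sigma> s"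

text \<open>Functions on the quotient are induced by functions of the representatives: the image of a
  class is a singleton.\<close>

definition pi_lambda ::
  "('n option \<Rightarrow> 'n mat1) \<Rightarrow> 'n zpoint \<Rightarrow> (complex ^ ('n::finite option)) set" where
  "pi_lambda \<sigma> P = the_elem ((\<lambda>(\<alpha>, p). cp_param \<sigma> \<alpha> (z_part p)) ` P)"

definition mu_plus ::
  "('n option \<Rightarrow> 'n mat1) \<Rightarrow> complex \<Rightarrow> 'n zpoint \<Rightarrow> ('n::finite) mat1" where
  "mu_plus \<sigma> s P = the_elem
     ((\<lambda>(\<alpha>, p). h_matrix \<sigma> s \<alpha> p ** lambda_dual s ** matrix_inv (h_matrix \<sigma> s \<alpha> p)) ` P)"

text \<open>The trace of $\mu_+\mu_+^*$ is real.\<close>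

definition tau ::
  "('n option \<Rightarrow> 'n mat1) \<Rightarrow> complex \<Rightarrow> ('n::finite) zpoint \<Rightarrow> real" where
  "tau \<sigma> s P = Re (trace (mu_plus \<sigma> s P ** conj_transpose (mu_plus \<sigma> s P)))
                + (cmod s)\<^sup>2 / (real CARD('n) + 1)"

definition chart_domain ::
  "('n option \<Rightarrow> 'n mat1) \<Rightarrow> complex \<Rightarrow> 'n option \<Rightarrow> ('n::finite) zpoint set" where
  "chart_domain \<sigma> s \<alpha> = {P \<in> twisted_cotangent \<sigma> s. pi_lambda \<sigma> P \<in> U_chart \<alpha>}"

definition coords :: "'n option \<Rightarrow> 'n zpoint \<Rightarrow> ('n::finite) cvec" where
  "coords \<alpha> P = (THE p. (\<alpha>, p) \<in> P)"

definition chart_point ::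
  "('n option \<Rightarrow> 'n mat1) \<Rightarrow> complex \<Rightarrow> 'n option \<Rightarrow> 'n cvec \<Rightarrow> ('n::finite) zpoint" where
  "chart_point \<sigma> s \<alpha> p = glue \<sigma> s `` {(\<alpha>, p)}"

definition tau_loc ::
  "('n option \<Rightarrow> 'n mat1) \<Rightarrow> complex \<Rightarrow> 'n option \<Rightarrow> ('n::finite) cvec \<Rightarrow> real" where
  "tau_loc \<sigma> s \<alpha> p = tau \<sigma> s (chart_point \<sigma> s \<alpha> p)"


section \<open>Differential forms on $\mathbb{C}^m$\<close>

text \<open>A one-form is a function of the base point and a tangent vector, a two-form a function of the
  base point and two tangent vectors. The tangent space of $\mathbb{C}^m$ at any point is
  \<open>complex ^ 'm\<close> viewed as a real vector space.\<close>

definition wedge :: "('v \<Rightarrow> complex) \<Rightarrow> ('v \<Rightarrow> complex) \<Rightarrow> 'v \<Rightarrow> 'v \<Rightarrow> complex" where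
  "wedge a b u v = a u * b v - a v * b u"

definition dz :: "'m \<Rightarrow> complex ^ 'm \<Rightarrow> complex" where
  "dz i v = v $ i"

definition dzbar :: "'m \<Rightarrow> complex ^ 'm \<Rightarrow> complex" where
  "dzbar i v = cnj (v $ i)"

definition wirtinger :: "(complex ^ 'm \<Rightarrow> real) \<Rightarrow> 'm \<Rightarrow> complex ^ ('m::finite) \<Rightarrow> complex" where
  "wirtinger g i p =
     (of_real (frechet_derivative g (at p) (axis i 1))
       - \<i> * of_real (frechet_derivative g (at p) (axis i \<i>))) / 2"

definition wirtinger_bar :: "(complex ^ 'm \<Rightarrow> real) \<Rightarrow> 'm \<Rightarrow> complex ^ ('m::finite) \<Rightarrow> complex" where
  "wirtinger_bar g i p =
     (of_real (frechet_derivative g (at p) (axis i 1))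
       + \<i> * of_real (frechet_derivative g (at p) (axis i \<i>))) / 2"

definition del :: "(complex ^ 'm \<Rightarrow> real) \<Rightarrow> complex ^ 'm \<Rightarrow> complex ^ ('m::finite) \<Rightarrow> complex" where
  "del g p v = (\<Sum>i\<in>UNIV. wirtinger g i p * dz i v)"

definition delbar :: "(complex ^ 'm \<Rightarrow> real) \<Rightarrow> complex ^ 'm \<Rightarrow> complex ^ ('m::finite) \<Rightarrow> complex" where
  "delbar g p v = (\<Sum>i\<in>UNIV. wirtinger_bar g i p * dzbar i v)"

definition ext_deriv ::
  "('v::real_normed_vector \<Rightarrow> 'v \<Rightarrow> complex) \<Rightarrow> 'v \<Rightarrow> 'v \<Rightarrow> 'v \<Rightarrow> complex" where
  "ext_deriv \<theta> p u v =
     frechet_derivative (\<lambda>q. \<theta> q v) (at p) u - frechet_derivative (\<lambda>q. \<theta> q u) (at p) v"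


section \<open>The symplectic forms and the endomorphisms in the chart of index $\alpha$\<close>

definition smooth_real :: "(real \<Rightarrow> real) \<Rightarrow> bool" where
  "smooth_real f \<longleftrightarrow> (\<forall>k x. (deriv ^^ k) f field_differentiable (at x))"

definition I_struct :: "complex ^ 'm \<Rightarrow> complex ^ 'm" where
  "I_struct v = \<i> *s v"

text \<open>The exterior derivative below is real valued, since its one-form is.\<close>

definition omega_I ::
  "('n option \<Rightarrow> 'n mat1) \<Rightarrow> complex \<Rightarrow> (real \<Rightarrow> real) \<Rightarrow> 'n option \<Rightarrow>
     'n cvec \<Rightarrow> 'n cvec \<Rightarrow> ('n::finite) cvec \<Rightarrow> real" where
  "omega_I \<sigma> s f \<alpha> p u v = Re (ext_deriv
     (\<lambda>q x. \<i> / 4 * of_real (f (tau_loc \<sigma> s \<alpha> q))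
             * (delbar (tau_loc \<sigma> s \<alpha>) q x - del (tau_loc \<sigma> s \<alpha>) q x)) p u v)"

text \<open>$\omega_+$ has constant coefficients in every chart, so \<open>omega_plus\<close> depends neither on the
  base point nor on $\alpha$.\<close>

definition omega_plus :: "('n::finite) cvec \<Rightarrow> 'n cvec \<Rightarrow> complex" where
  "omega_plus u v = (\<Sum>i\<in>UNIV. wedge (dz (Inl i)) (dz (Inr i)) u v)"

definition omega_J :: "('n::finite) cvec \<Rightarrow> 'n cvec \<Rightarrow> real" where
  "omega_J u v = Re (omega_plus u v)"

definition omega_K :: "('n::finite) cvec \<Rightarrow> 'n cvec \<Rightarrow> real" where
  "omega_K u v = Im (omega_plus u v)"

definition flat :: "('v \<Rightarrow> 'v \<Rightarrow> real) \<Rightarrow> 'v \<Rightarrow> ('v \<Rightarrow> real)" where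
  "flat \<omega> v = (\<lambda>w. \<omega> v w)"

definition J_endo ::
  "('n option \<Rightarrow> 'n mat1) \<Rightarrow> complex \<Rightarrow> (real \<Rightarrow> real) \<Rightarrow> 'n option \<Rightarrow>
     'n cvec \<Rightarrow> 'n cvec \<Rightarrow> ('n::finite) cvec" where
  "J_endo \<sigma> s f \<alpha> p = inv (flat (omega_I \<sigma> s f \<alpha> p)) \<circ> flat omega_K"

definition K_endo ::
  "('n option \<Rightarrow> 'n mat1) \<Rightarrow> complex \<Rightarrow> (real \<Rightarrow> real) \<Rightarrow> 'n option \<Rightarrow>
     'n cvec \<Rightarrow> 'n cvec \<Rightarrow> ('n::finite) cvec" where
  "K_endo \<sigma> s f \<alpha> p = inv (flat omega_J) \<circ> flat (omega_I \<sigma> s f \<alpha> p)"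

text \<open>The complexification of a real vector space \<open>V\<close> is $V \times V$, with \<open>(x, y)\<close>
  standing for $x + \sqrt{-1}\,y$.\<close>

definition complexify :: "('v \<Rightarrow> 'v) \<Rightarrow> 'v \<times> 'v \<Rightarrow> 'v \<times> 'v" where
  "complexify T = (\<lambda>(x, y). (T x, T y))"

text \<open>The components $g_{i\bar j}$, defined by
  $\omega_I = \frac{\sqrt{-1}}{2}\sum_{i,j} g_{i\bar j}\,\mathrm{d}z_i \wedge \mathrm{d}\bar z_j$.\<close>

definition A_matrix ::
  "('n option \<Rightarrow> 'n mat1) \<Rightarrow> complex \<Rightarrow> (real \<Rightarrow> real) \<Rightarrow> 'n option \<Rightarrow>
     'n cvec \<Rightarrow> complex ^ ('n + 'n) ^ ('n::finite + 'n)" where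
  "A_matrix \<sigma> s f \<alpha> p = (THE g. \<forall>u v.
     of_real (omega_I \<sigma> s f \<alpha> p u v) =
       \<i> / 2 * (\<Sum>i\<in>UNIV. \<Sum>j\<in>UNIV. g $ i $ j * wedge (dz i) (dzbar j) u v))"

definition S_matrix :: "complex ^ ('n + 'n) ^ ('n::finite + 'n)" where
  "S_matrix = (\<chi> i j. case (i, j) of
      (Inl k, Inr l) \<Rightarrow> if k = l then 1 else 0
    | (Inr k, Inl l) \<Rightarrow> if k = l then - 1 else 0
    | _ \<Rightarrow> 0)"

end

theory Submission
  imports Defs
begin

text \<open>
  At a fixed point the statement is linear algebra. Let \<open>g\<close> be the Hermitian matrix of $\omega_I$ and
  put $\bar v$ for the entrywise conjugate. Since $\omega_I(u, v) = -\mathrm{Im}({}^tu\,g\,\bar v)$ and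
  $\omega_+(u, v) = {}^tu\,S\,v$, the equation $\omega_J(Ku, v) = \omega_I(u, v)$ is solved by
  $Ku = -\sqrt{-1}\,S g \bar u$. This map is conjugate-linear, so that
  $K^2 = S g S \bar g$, and $K^2 = -1$ means $g S \bar g = S$; conjugating and using
  $\bar g = {}^tg$ gives ${}^tg S g = S$. The condition on \<open>J\<close> comes for free: from
  $\omega_K = -\omega_J(I\cdot, \cdot)$ one gets $J = -K^{-1}I$, hence $J = KI$ and
  $J^2 = KIKI = -K^2I^2 = K^2$ as soon as $K^2 = -1$. Positivity of $\omega_I$ makes it nondegenerate.
  This is \<open>quaternionic_iff_symplectic\<close>.

  What has to be supplied is that $\omega_I$ really has components $g_{i\bar j}$, that is, that it is a
  real form of type $(1,1)$. Since $\overline\partial\tau - \partial\tau = \sqrt{-1}\,d\tau(I\cdot)$, the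
  form is an explicit expression in the first two derivatives of $\tau$, and its invariance under \<open>I\<close>
  is the symmetry of the second derivative (\<open>ddc_form_one_one\<close>). So it is enough that $\tau$ is a
  polynomial in the real coordinates of each chart.

  In the chart, $\tau$ is computed from $h\lambda^\vee h^{-1}$ with $h = \sigma_\alpha u_z u^-_w$, whose
  entries are polynomial because the inverses of unipotent matrices are. But $\tau$ lives on the quotient,
  so this needs that glued points have the same $\mu_+$. The gluing
  relation is stated through derivatives; \<open>glue_iff\<close> shows that it says exactly
  $\sigma_\beta u_{z_\beta}u^-_{w_\beta} = \sigma_\alpha u_{z_\alpha}u^-_{w_\alpha}t$ with the block
  diagonal $t = t_{\alpha\beta}$, and \<open>t\<close> commutes with $\lambda^\vee$. Both sides of the gluing
  condition can be written down explicitly, because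
  $\sigma_\beta^{-1}\sigma_\alpha u_{z_\alpha}$ has a block triangular factorisation
  in which $t_{\alpha\beta}$ depends on $z_\alpha$ alone.
\<close>

section \<open>Block matrices\<close>

definition pairing :: "complex ^ 'n \<Rightarrow> complex ^ 'n \<Rightarrow> complex" where
  "pairing x y = (\<Sum>i\<in>UNIV. x $ i * y $ (i::'n::finite))"

definition outer :: "complex ^ 'm \<Rightarrow> complex ^ 'n \<Rightarrow> complex ^ 'n ^ 'm" where
  "outer x y = (\<chi> i j. x $ i * y $ j)"

lemma pairing_simps:
  "pairing (x + y) z = pairing x z + pairing y z" "pairing x (y + z) = pairing x y + pairing x z"
  "pairing (x - y) z = pairing x z - pairing y z" "pairing x (y - z) = pairing x y - pairing x z"
  "pairing (k *s x) y = k * pairing x y" "pairing x (k *s y) = k * pairing x y"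
  "pairing 0 x = 0" "pairing x 0 = 0" "pairing (- x) y = - pairing x y" "pairing x (- y) = - pairing x y"
  by (simp_all add: pairing_def algebra_simps sum.distrib sum_subtractf sum_distrib_left sum_negf)

lemma pairing_axis: "pairing x (axis i k) = x $ i * k"
  by (simp add: pairing_def axis_def if_distrib cong: if_cong)

lemma pairing_vector_matrix: "pairing (x v* A) y = pairing x (A *v y)"
  unfolding pairing_def vector_matrix_mult_def matrix_vector_mult_def
  by (simp add: sum_distrib_left sum_distrib_right mult_ac) (rule sum.swap)

lemma outer_simps:
  "outer (x + y) z = outer x z + outer y z" "outer x (y + z) = outer x y + outer x z"
  "outer (x - y) z = outer x z - outer y z" "outer x (y - z) = outer x y - outer x z"
  "outer 0 x = 0" "outer x 0 = 0" "outer (k *s x) y = outer x (k *s y)"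
  "outer (- x) y = - outer x y" "outer x (- y) = - outer x y"
  by (simp_all add: outer_def vec_eq_iff algebra_simps)

lemma outer_mult: "A ** outer x y = outer (A *v x) y" "outer x y ** A = outer x (y v* A)"
  "outer x y *v v = pairing y v *s x" "v v* outer x y = pairing v x *s y"
  by (simp_all add: outer_def pairing_def vec_eq_iff matrix_matrix_mult_def matrix_vector_mult_def
      vector_matrix_mult_def sum_distrib_left sum_distrib_right mult_ac)

lemma trace_outer: "trace (outer x y) = pairing y x"
  by (simp add: trace_def outer_def pairing_def mult.commute)

lemma matrix_mult_distrib:
  fixes A B C :: "complex ^ _ ^ _"
  shows "A ** (B - C) = A ** B - A ** C" "(A - B) ** C = A ** C - B ** C"
    "(A + B) ** C = A ** C + B ** C" "A ** (- C) = - (A ** C)" "(- A) ** C = - (A ** C)"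
  by (simp_all add: vec_eq_iff matrix_matrix_mult_def algebra_simps sum_subtractf sum.distrib sum_negf)

lemma matrix_vector_minus:
  fixes A :: "complex ^ _ ^ _"
  shows "(- A) *v x = - (A *v x)" "A *v (- x) = - (A *v x)"
  by (simp_all add: vec_eq_iff matrix_vector_mult_def sum_negf)

lemma mat_mult_commute:
  fixes A :: "complex ^ 'n ^ 'n"
  shows "mat k ** A = A ** mat k"
  by (simp add: vec_eq_iff matrix_matrix_mult_def mat_def if_distrib if_distribR mult.commute cong: if_cong)

lemma trace_mat_mult:
  fixes A :: "complex ^ 'n ^ 'n"
  shows "trace (mat k ** A) = k * trace A"
  by (simp add: trace_def vec_eq_iff matrix_matrix_mult_def mat_def if_distrib if_distribR sum_distrib_left cong: if_cong)

lemma matrix_inv_eqI: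
  fixes A :: "complex ^ 'n ^ 'n"
  assumes "A ** B = mat 1"
  shows "matrix_inv A = B"
proof -
  have BA: "B ** A = mat 1" using assms matrix_left_right_inverse by blast
  have "\<exists>A'. A ** A' = mat 1 \<and> A' ** A = mat 1" using assms BA by blast
  then have "A ** matrix_inv A = mat 1 \<and> matrix_inv A ** A = mat 1"
    unfolding matrix_inv_def by (rule someI_ex)
  then have "matrix_inv A ** (A ** B) = B" by (simp add: matrix_mul_assoc)
  then show ?thesis by (simp add: assms)
qed

lemma sum_option: "(\<Sum>i\<in>UNIV. g i) = g None + (\<Sum>i\<in>UNIV. g (Some (i::'n::finite)))"
proof -
  have "(\<Sum>i\<in>range Some. g i) = (\<Sum>i\<in>UNIV. g (Some (i::'n)))"
    by (rule sum.reindex_cong[of Some]) auto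
  then show ?thesis by (simp add: UNIV_option_conv)
qed

lemma forall_option: "(\<forall>i. P i) \<longleftrightarrow> P None \<and> (\<forall>i. P (Some i))"
  by (metis option.exhaust)

lemma block_mult:
  "block a b c d ** block a' b' c' d' =
     block (a ** a' + outer b c') (a *v b' + d' *s b) (c v* a' + d *s c') (pairing c b' + d * d')"
  by (simp add: vec_eq_iff forall_option block_def matrix_matrix_mult_def matrix_vector_mult_def
      vector_matrix_mult_def outer_def pairing_def sum_option algebra_simps)

lemma block_eq_iff: "block a b c d = block a' b' c' d' \<longleftrightarrow> a = a' \<and> b = b' \<and> c = c' \<and> d = d'"
  by (auto simp add: vec_eq_iff forall_option block_def)

lemma mat_1_block: "mat 1 = block (mat 1) 0 0 1"
  by (auto simp add: vec_eq_iff forall_option block_def mat_def)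

lemma block_exhaust: obtains a b c d where "M = block a b c d"
proof
  show "M = block (\<chi> i j. M $ Some i $ Some j) (\<chi> i. M $ Some i $ None)
      (\<chi> j. M $ None $ Some j) (M $ None $ None)"
    by (auto simp add: vec_eq_iff forall_option block_def)
qed

lemma trace_block: "trace (block a b c d) = trace a + d"
  by (simp add: trace_def sum_option block_def)

lemma u_plus_inverse: "u_plus z ** u_plus (- z) = mat 1"
  and u_minus_inverse: "u_minus z ** u_minus (- z) = mat 1"
  by (simp_all add: u_plus_def u_minus_def block_mult mat_1_block outer_simps pairing_simps)

lemma unipotent_product: "u_plus z ** u_minus w = block (mat 1 + outer z w) z w 1"
  by (simp add: u_plus_def u_minus_def block_mult outer_simps pairing_simps)

section \<open>Linear fractional maps and block factorisation\<close>

text \<open>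
  The block matrix \<open>M\<close> with entries \<open>a, b, c, d\<close> stands for a change of chart
  $\sigma_\beta^{-1}\sigma_\alpha$. The primed entries are those of its inverse; they make the inverse of
  the Schur complement below affine in \<open>z\<close>, which spares differentiating a determinant or an inverse matrix.
\<close>

locale inverse_blocks =
  fixes a a' :: "complex ^ 'n::finite ^ 'n" and b b' c c' :: "complex ^ 'n" and d d' :: complex
  assumes left_inverse: "block a' b' c' d' ** block a b c d = mat 1"
begin

lemma block_relations:
  "a' ** a = mat 1 - outer b' c" "a' *v b = - d *s b'" "c' v* a = - d' *s c"
  "pairing c' b = 1 - d' * d"
  using left_inverse unfolding block_mult mat_1_block block_eq_iff
  by (simp_all add: algebra_simps eq_neg_iff_add_eq_0)

text \<open>
  \<open>M u_z\<close> has last column $(az + b, cz + d)$. Its Schur complement with respect to the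
  corner entry $cz + d$ is \<open>schur z\<close>.
\<close>

definition den where "den z = pairing c z + d"
definition moebius where "moebius z = (1 / den z) *s (a *v z + b)"
definition schur where "schur z = a - outer (moebius z) c"
definition schur_inverse where "schur_inverse z = a' - outer z c'"

lemma pairing_moebius:
  assumes "den z \<noteq> 0"
  shows "pairing c' (moebius z) = 1 / den z - d'"
proof -
  have "pairing c' (a *v z + b) = 1 - d' * den z"
    unfolding pairing_simps pairing_vector_matrix[symmetric] block_relations den_def
    by (simp add: pairing_simps algebra_simps)
  then show ?thesis using assms by (simp add: moebius_def pairing_simps field_simps)
qed

lemma inverse_moebius:
  assumes "den z \<noteq> 0"
  shows "a' *v moebius z = (1 / den z) *s z - b'"
proof -
  have "a' *v (a *v z + b) = z - den z *s b'"
    unfolding matrix_vector_right_distrib matrix_vector_mul_assoc block_relations den_def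
    by (simp add: matrix_vector_mult_diff_rdistrib outer_mult vec_eq_iff algebra_simps)
  then have "a' *v moebius z = (1 / den z) *s (z - den z *s b')"
    unfolding moebius_def vector_scalar_commute by simp
  then show ?thesis using assms by (simp add: vec_eq_iff field_simps)
qed

lemma row_schur:
  assumes "den z \<noteq> 0"
  shows "c' v* schur z = - (1 / den z) *s c"
  unfolding schur_def vector_matrix_mult_diff_rdistrib outer_mult block_relations
    pairing_moebius[OF assms]
  by (simp add: vec_eq_iff algebra_simps)

lemma schur_inverse_schur:
  assumes "den z \<noteq> 0"
  shows "schur_inverse z ** schur z = mat 1"
proof -
  have "schur_inverse z ** schur z = a' ** schur z - outer z (c' v* schur z)"
    by (simp add: schur_inverse_def matrix_mult_distrib outer_mult)
  also have "a' ** schur z = mat 1 - outer z ((1 / den z) *s c)"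
    unfolding schur_def matrix_mult_distrib outer_mult block_relations inverse_moebius[OF assms]
    by (simp add: outer_simps)
  also have "outer z (c' v* schur z) = - outer z ((1 / den z) *s c)"
    unfolding row_schur[OF assms] by (simp add: outer_def vec_eq_iff)
  finally show ?thesis by simp
qed

lemma schur_schur_inverse: "den z \<noteq> 0 \<Longrightarrow> schur z ** schur_inverse z = mat 1"
  using schur_inverse_schur matrix_left_right_inverse by blast

lemma den_moebius: "den z \<noteq> 0 \<Longrightarrow> den z *s moebius z = a *v z + b"
  by (simp add: moebius_def vec_eq_iff)

text \<open>
  The cocycle $t_{\alpha\beta}$ as an explicit function of $z_\alpha$.
\<close>

definition levi where "levi z = block (schur_inverse z) 0 0 (1 / den z)"

lemma product_eq:
  "block a b c d ** u_plus z ** u_minus w =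
     block (a + outer (a *v z + b) w) (a *v z + b) (c + den z *s w) (den z)"
  by (simp add: u_plus_def u_minus_def block_mult den_def outer_simps pairing_simps matrix_vector_right_distrib)

text \<open>
  Clearing the last column of $M u_z u^-_w$ from the left and its last row from the right leaves the Schur
  complement and the corner entry, whose inverses make up \<open>levi\<close>. Multiplying by $u^-_w$ on the
  right adds multiples of the last column to the others, which does not change the Schur complement.
  That is why the block diagonal factor is independent of \<open>w\<close>.
\<close>

lemma factorisation:
  assumes "den z \<noteq> 0"
  shows "block a b c d ** u_plus z ** u_minus w ** levi z =
    u_plus (moebius z) ** u_minus ((c + den z *s w) v* schur_inverse z)"
proof -
  have "a + outer (a *v z + b) w = schur z + outer (moebius z) (c + den z *s w)"
    by (simp add: schur_def outer_simps den_moebius[OF assms, symmetric])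
  then have "(a + outer (a *v z + b) w) ** schur_inverse z
      = mat 1 + outer (moebius z) ((c + den z *s w) v* schur_inverse z)"
    by (simp add: matrix_mult_distrib schur_schur_inverse[OF assms] outer_mult)
  then show ?thesis unfolding product_eq unipotent_product levi_def block_mult
    using assms by (simp add: outer_simps pairing_simps moebius_def)
qed

lemma factorisation_unique:
  assumes "den z \<noteq> 0"
    and "block a b c d ** u_plus z ** u_minus w ** block x 0 0 y = u_plus (moebius z) ** u_minus w'"
  shows "block x 0 0 y = levi z"
proof -
  have eqs: "(a + outer (a *v z + b) w) ** x = mat 1 + outer (moebius z) w'"
    "(c + den z *s w) v* x = w'" "den z * y = 1"
    using assms(2) unfolding product_eq unipotent_product block_mult block_eq_iff
    by (simp_all add: outer_simps pairing_simps)
  have "a + outer (a *v z + b) w = schur z + outer (moebius z) (c + den z *s w)"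
    by (simp add: schur_def outer_simps den_moebius[OF assms(1), symmetric])
  with eqs(1) have "schur z ** x = mat 1"
    by (simp add: matrix_mult_distrib outer_mult eqs(2))
  then have "schur_inverse z ** (schur z ** x) = schur_inverse z" by simp
  then have "x = schur_inverse z" by (simp add: matrix_mul_assoc schur_inverse_schur[OF assms(1)])
  moreover have "y = 1 / den z" using eqs(3) assms(1) by (simp add: field_simps)
  ultimately show ?thesis by (simp add: levi_def)
qed

end

section \<open>Derivatives of the change of chart\<close>

lemma has_derivative_vecI:
  fixes g :: "'a::real_normed_vector \<Rightarrow> 'b::euclidean_space ^ 'm"
  assumes "\<And>i. ((\<lambda>x. g x $ i) has_derivative (\<lambda>h. g' h $ i)) (at p)"
  shows "(g has_derivative g') (at p)"
  unfolding has_derivative_componentwise_within[of g]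
proof
  fix e :: "'b ^ 'm" assume "e \<in> Basis"
  then obtain i u where e: "e = axis i u" by (auto simp: Basis_vec_def)
  show "((\<lambda>x. g x \<bullet> e) has_derivative (\<lambda>h. g' h \<bullet> e)) (at p)"
    unfolding e inner_axis by (rule has_derivative_inner_left[OF assms])
qed

lemma bounded_linear_pairing: "bounded_linear (pairing c)"
  unfolding linear_conv_bounded_linear[symmetric]
  by (rule linearI) (simp_all add: pairing_def algebra_simps sum.distrib scaleR_sum_right)

lemma bounded_linear_matrix_vector: "bounded_linear (\<lambda>z::complex^'n. (A::complex^'n^'m) *v z)"
  unfolding linear_conv_bounded_linear[symmetric] by (rule matrix_vector_mul_linear)

context inverse_blocks begin

lemma has_derivative_den: "(den has_derivative pairing c) (at z)"
  unfolding den_def[abs_def]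
  by (auto intro!: derivative_eq_intros bounded_linear_imp_has_derivative bounded_linear_pairing)

lemma has_derivative_inverse_den:
  assumes "den z \<noteq> 0"
  shows "((\<lambda>z. 1 / den z) has_derivative (\<lambda>v. - pairing c v / (den z)\<^sup>2)) (at z)"
  using has_derivative_divide[OF has_derivative_const has_derivative_den assms, of 1]
  by (simp add: power2_eq_square inverse_eq_divide)

lemma has_derivative_moebius:
  assumes "den z \<noteq> 0"
  shows "(moebius has_derivative (\<lambda>v. (1 / den z) *s (schur z *v v))) (at z)"
proof (rule has_derivative_vecI)
  fix i
  have "((\<lambda>z. (a *v z) $ i) has_derivative (\<lambda>v. (a *v v) $ i)) (at z)"
    by (intro bounded_linear_imp_has_derivative
        bounded_linear_compose[OF bounded_linear_vec_nth bounded_linear_matrix_vector])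
  then have "((\<lambda>z. (a *v z) $ i + b $ i) has_derivative (\<lambda>v. (a *v v) $ i)) (at z)"
    by (auto intro!: derivative_eq_intros)
  from has_derivative_mult[OF has_derivative_inverse_den[OF assms] this]
  have "((\<lambda>z. (1 / den z) * ((a *v z) $ i + b $ i)) has_derivative
     (\<lambda>v. (1 / den z) * (a *v v) $ i + (- pairing c v / (den z)\<^sup>2) * ((a *v z) $ i + b $ i))) (at z)" .
  moreover have "(1 / den z) * (a *v v) $ i + (- pairing c v / (den z)\<^sup>2) * ((a *v z) $ i + b $ i)
     = ((1 / den z) *s (schur z *v v)) $ i" for v
    using assms
    by (simp add: schur_def matrix_vector_mult_diff_rdistrib outer_mult moebius_def field_simps power2_eq_square)
  ultimately show "((\<lambda>z. moebius z $ i) has_derivative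
      (\<lambda>v. ((1 / den z) *s (schur z *v v)) $ i)) (at z)"
    by (simp add: moebius_def add_divide_distrib)
qed

lemma has_derivative_levi:
  assumes "den z \<noteq> 0"
  shows "(levi has_derivative (\<lambda>v. block (- outer v c') 0 0 (- pairing c v / (den z)\<^sup>2))) (at z)"
proof (intro has_derivative_vecI)
  fix i j :: "'n option"
  have nth: "((\<lambda>z. z $ k) has_derivative (\<lambda>v. v $ k)) (at z)" for k :: 'n
    by (intro bounded_linear_imp_has_derivative bounded_linear_vec_nth)
  note [derivative_intros] = nth has_derivative_inverse_den[OF assms]
  show "((\<lambda>z. levi z $ i $ j) has_derivative
      (\<lambda>v. block (- outer v c') 0 0 (- pairing c v / (den z)\<^sup>2) $ i $ j)) (at z)"
    unfolding levi_def block_def schur_inverse_def outer_def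
    by (cases i; cases j) (auto intro!: derivative_eq_intros)
qed

lemma levi_inverse:
  assumes "den z \<noteq> 0"
  shows "levi z ** block (schur z) 0 0 (den z) = mat 1"
  using assms by (simp add: levi_def block_mult schur_inverse_schur outer_simps pairing_simps mat_1_block)

text \<open>
  The logarithmic derivative of \<open>levi\<close> has the blocks $\frac{1}{cz+d}\,v c$ and
  $-\frac{cv}{cz+d}$: a matrix of trace zero, on which $\lambda$ is $-s$ times the corner entry.
\<close>

lemma lambda_pair_levi:
  assumes "den z \<noteq> 0"
  shows "lambda_pair s (block (- outer v c') 0 0 (- (pairing c v / (den z)\<^sup>2)) ** matrix_inv (levi z))
     = s * pairing c v / den z"
proof -
  have n: "of_nat CARD('n) + 1 \<noteq> (0::complex)"
    by (metis of_nat_1 of_nat_add of_nat_eq_0_iff add_is_0 one_neq_zero)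
  have "matrix_inv (levi z) = block (schur z) 0 0 (den z)"
    by (rule matrix_inv_eqI[OF levi_inverse[OF assms]])
  then have "block (- outer v c') 0 0 (- (pairing c v / (den z)\<^sup>2)) ** matrix_inv (levi z)
     = block (outer v ((1 / den z) *s c)) 0 0 (- pairing c v / den z)"
    using assms by (simp add: block_mult outer_simps pairing_simps matrix_mult_distrib outer_mult row_schur power2_eq_square)
  then show ?thesis using assms n
    by (simp add: lambda_pair_def lambda_dual_def block_mult outer_simps pairing_simps trace_block
       trace_mat_mult trace_outer divide_simps)
     (simp add: algebra_simps)
qed

end

section \<open>The gluing relation\<close>

lemma cycle_of_list_last:
  "distinct (xs @ [x]) \<Longrightarrow> cycle_of_list (xs @ [x]) x = hd (xs @ [x])"
proof (induction xs)
  case (Cons y ys)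
  have IH: "cycle_of_list (ys @ [x]) x = hd (ys @ [x])" using Cons by simp
  show ?case by (cases "ys @ [x]") (use IH in auto)
qed simp

lemma cycle_list_last: "cycle_of_list (cycle_list \<beta>) None = (\<beta> :: 'n::{finite,linorder} option)"
proof (cases \<beta>)
  case (Some b)
  let ?xs = "sorted_list_of_set {b..}"
  have "?xs = b # sorted_list_of_set ({b..} - {b})"
  proof -
    have "Min {b..} = b" by (rule Min_eqI) auto
    then show ?thesis by (subst sorted_list_of_set_nonempty) auto
  qed
  then have "hd (map Some ?xs @ [None]) = Some b" by simp
  moreover have "distinct (map Some ?xs @ [None])" by (auto simp: distinct_map)
  ultimately show ?thesis using Some cycle_of_list_last[of "map Some ?xs" None] by simp
qed simp

text \<open>
  Only the last column of $\sigma_\beta$ meets the row $\beta$, since the cycle sends \<open>n\<close> to $\beta$.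
  This turns the coordinate that defines $U_\beta$ into the denominator \<open>den\<close>.
\<close>

lemma sigma_row:
  assumes "admissible_sigma \<sigma>"
  obtains e where "e \<noteq> 0" "\<And>y. (\<sigma> \<beta> *v y) $ \<beta> = e * y $ None"
proof -
  let ?\<pi> = "cycle_of_list (cycle_list \<beta>)"
  obtain \<epsilon> where \<epsilon>: "\<forall>j. \<epsilon> j \<in> {1, -1}" and M: "\<sigma> \<beta> = (\<chi> i j. if i = ?\<pi> j then \<epsilon> j else 0)"
    using assms unfolding admissible_sigma_def signed_perm_matrix_def by blast
  have inj: "inj ?\<pi>" using cycle_permutes permutes_inj by blast
  have iff: "\<beta> = ?\<pi> j \<longleftrightarrow> j = None" for j
    using injD[OF inj, of j None] by (auto simp: cycle_list_last)
  have "(\<sigma> \<beta> *v y) $ \<beta> = \<epsilon> None * y $ None" for y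
    by (simp add: M matrix_vector_mult_def iff if_distrib if_distribR cong: if_cong)
  moreover have "\<epsilon> None \<noteq> 0" using \<epsilon> by (metis insertE singletonD zero_neq_neg_one zero_neq_one)
  ultimately show thesis using that by blast
qed

lemma sigma_inverse:
  assumes "admissible_sigma \<sigma>"
  shows "matrix_inv (\<sigma> \<beta>) ** \<sigma> \<beta> = mat 1" "\<sigma> \<beta> ** matrix_inv (\<sigma> \<beta>) = mat 1"
proof -
  have "det (\<sigma> \<beta>) \<noteq> 0" using assms by (auto simp: admissible_sigma_def SL_def)
  then obtain B where "\<sigma> \<beta> ** B = mat 1" unfolding invertible_det_nz[symmetric] invertible_def by blast
  with matrix_inv_eqI[OF this] show "matrix_inv (\<sigma> \<beta>) ** \<sigma> \<beta> = mat 1" "\<sigma> \<beta> ** matrix_inv (\<sigma> \<beta>) = mat 1"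
    using matrix_left_right_inverse by blast+
qed

lemma proj_point_eq_iff: "proj_point x = proj_point y \<longleftrightarrow> (\<exists>k. k \<noteq> 0 \<and> x = k *s y)"
proof
  assume "proj_point x = proj_point y"
  moreover have "x \<in> proj_point x" unfolding proj_point_def by (intro CollectI exI[of _ 1]) simp
  ultimately show "\<exists>k. k \<noteq> 0 \<and> x = k *s y" by (auto simp: proj_point_def)
next
  assume "\<exists>k. k \<noteq> 0 \<and> x = k *s y"
  then obtain k where k: "k \<noteq> 0" "x = k *s y" by blast
  show "proj_point x = proj_point y"
  proof (intro equalityI subsetI)
    fix u assume "u \<in> proj_point x"
    then obtain c where "c \<noteq> 0" "u = c *s x" by (auto simp: proj_point_def)
    then have "c * k \<noteq> 0 \<and> u = (c * k) *s y" using k by simp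
    then show "u \<in> proj_point y" unfolding proj_point_def by blast
  next
    fix u assume "u \<in> proj_point y"
    then obtain c where "c \<noteq> 0" "u = c *s y" by (auto simp: proj_point_def)
    then have "c / k \<noteq> 0 \<and> u = (c / k) *s x" using k by simp
    then show "u \<in> proj_point x" unfolding proj_point_def by blast
  qed
qed

definition affine_lift :: "complex ^ 'n \<Rightarrow> complex \<Rightarrow> complex ^ ('n::finite option)" where
  "affine_lift x k = (\<chi> i. case i of Some j \<Rightarrow> x $ j | None \<Rightarrow> k)"

lemma block_affine_lift:
  "block a b c d *v affine_lift x k = affine_lift (a *v x + k *s b) (pairing c x + d * k)"
  by (simp add: vec_eq_iff forall_option affine_lift_def block_def matrix_vector_mult_def sum_option pairing_def)

lemma e_last_affine_lift: "e_last = affine_lift 0 1"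
  by (simp add: e_last_def affine_lift_def vec_eq_iff forall_option axis_def)

lemma u_plus_e_last: "u_plus z *v e_last = affine_lift z 1"
  unfolding u_plus_def e_last_affine_lift block_affine_lift by (simp add: pairing_simps)

text \<open>
  Adding to the last row of the identity a combination of the other rows leaves the determinant unchanged.
\<close>

lemma det_u_minus: "det (u_minus w) = 1"
proof -
  let ?A = "mat 1 :: 'a mat1"
  let ?x = "\<Sum>j\<in>UNIV. w $ j *s row (Some j) ?A"
  have "?x \<in> vec.span {row j ?A |j. j \<noteq> None}"
    by (intro vec.span_sum vec.span_scale vec.span_base) auto
  then have "det (\<chi> k. if k = None then row None ?A + ?x else row k ?A) = det ?A"
    by (rule det_row_span)
  moreover have "(\<chi> k. if k = None then row None ?A + ?x else row k ?A) = u_minus w"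
    by (auto simp: vec_eq_iff forall_option u_minus_def block_def row_def mat_def if_distrib cong: if_cong)
  ultimately show ?thesis by simp
qed

lemma det_u_plus: "det (u_plus z) = 1"
proof -
  have "u_plus z = transpose (u_minus z)"
    by (auto simp: vec_eq_iff forall_option u_minus_def u_plus_def block_def mat_def transpose_def)
  then show ?thesis by (simp add: det_u_minus)
qed

lemma vec_split:
  obtains p :: "('n::finite) cvec" where "z_part p = x" "xi_part p = y"
proof
  show "z_part (\<chi> i. case i of Inl k \<Rightarrow> x $ k | Inr k \<Rightarrow> y $ k) = x"
    "xi_part (\<chi> i. case i of Inl k \<Rightarrow> x $ k | Inr k \<Rightarrow> y $ k) = y"
    by (simp_all add: z_part_def xi_part_def vec_eq_iff)
qed

lemma bounded_linear_z_part: "bounded_linear z_part"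
  unfolding linear_conv_bounded_linear[symmetric]
  by (rule linearI) (simp_all add: z_part_def vec_eq_iff)

lemma xi_part_w_part: "s \<noteq> 0 \<Longrightarrow> xi_part p = - (s *s w_part s p)"
  by (simp add: w_part_def vec_eq_iff)

locale chart_change = inverse_blocks a a' b b' c c' d d'
  for a a' :: "complex ^ ('n::{finite,linorder}) ^ ('n::{finite,linorder})"
    and b b' c c' :: "complex ^ ('n::{finite,linorder})" and d d' :: complex +
  fixes \<sigma> :: "'n option \<Rightarrow> 'n mat1" and s :: complex and \<alpha> \<beta> :: "'n option"
  assumes sigma: "admissible_sigma \<sigma>" and s: "s \<noteq> 0"
    and transition: "\<sigma> \<alpha> = \<sigma> \<beta> ** block a b c d"
begin

lemma sigma_affine_lift:
  "\<sigma> \<alpha> ** u_plus z *v e_last = \<sigma> \<beta> *v affine_lift (a *v z + b) (den z)"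
proof -
  have "\<sigma> \<alpha> ** u_plus z *v e_last = \<sigma> \<beta> *v (block a b c d *v affine_lift z 1)"
    unfolding transition by (simp only: matrix_vector_mul_assoc[symmetric] u_plus_e_last)
  then show ?thesis by (simp only: block_affine_lift den_def vector_smult_lid mult_1_right)
qed

lemma cp_param_eq_iff: "cp_param \<sigma> \<alpha> z = cp_param \<sigma> \<beta> z' \<longleftrightarrow> den z \<noteq> 0 \<and> z' = moebius z"
proof -
  have eq': "\<sigma> \<beta> ** u_plus z' *v e_last = \<sigma> \<beta> *v affine_lift z' 1"
    by (simp only: matrix_vector_mul_assoc[symmetric] u_plus_e_last)
  have "inj ((*v) (\<sigma> \<beta>))"
    using sigma_inverse[OF sigma] matrix_left_invertible_injective by blast
  then have inj: "\<sigma> \<beta> *v x = \<sigma> \<beta> *v y \<longleftrightarrow> x = y" for x y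
    by (rule inj_eq)
  have "affine_lift (a *v z + b) (den z) = k *s affine_lift z' 1 \<longleftrightarrow> a *v z + b = k *s z' \<and> den z = k" for k
    by (auto simp: affine_lift_def vec_eq_iff forall_option)
  then have "cp_param \<sigma> \<alpha> z = cp_param \<sigma> \<beta> z' \<longleftrightarrow> den z \<noteq> 0 \<and> a *v z + b = den z *s z'"
    unfolding cp_param_def proj_point_eq_iff sigma_affine_lift eq' vector_scalar_commute[symmetric] inj by auto
  also have "\<dots> \<longleftrightarrow> den z \<noteq> 0 \<and> z' = moebius z"
  proof -
    have "x = k *s y \<longleftrightarrow> y = (1 / k) *s x" if "k \<noteq> 0" for k and x y :: "complex ^ ('n::{finite,linorder})"
      using that by auto
    then show ?thesis unfolding moebius_def by blast
  qed
  finally show ?thesis .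
qed

lemma cp_param_in_U_chart: "cp_param \<sigma> \<alpha> z \<in> U_chart \<beta> \<longleftrightarrow> den z \<noteq> 0"
proof -
  obtain e where e: "e \<noteq> 0" "\<And>y. (\<sigma> \<beta> *v y) $ \<beta> = e * y $ None"
    using sigma_row[OF sigma, of \<beta>] by blast
  have "proj_point x \<in> U_chart \<beta> \<longleftrightarrow> x $ \<beta> \<noteq> 0" for x
  proof
    assume "proj_point x \<in> U_chart \<beta>"
    then obtain y k where "k \<noteq> 0" "x = k *s y" "y $ \<beta> \<noteq> 0"
      unfolding U_chart_def mem_Collect_eq proj_point_eq_iff by blast
    then show "x $ \<beta> \<noteq> 0" by simp
  qed (auto simp: U_chart_def)
  then have "cp_param \<sigma> \<alpha> z \<in> U_chart \<beta> \<longleftrightarrow> (\<sigma> \<beta> *v affine_lift (a *v z + b) (den z)) $ \<beta> \<noteq> 0"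
    unfolding cp_param_def sigma_affine_lift .
  then show ?thesis unfolding e(2) using e(1) by (simp add: affine_lift_def)
qed

end

text \<open>
  The change from a chart to itself has \<open>M = 1\<close>, for which \<open>moebius\<close> is the identity.
\<close>

lemma inj_cp_param:
  fixes \<sigma> :: "'n::{finite,linorder} option \<Rightarrow> 'n mat1"
  assumes "admissible_sigma \<sigma>"
  shows "inj (cp_param \<sigma> \<beta>)"
proof -
  interpret chart_change "mat 1" "mat 1" 0 0 0 0 1 1 \<sigma> 1 \<beta> \<beta>
    using assms by unfold_locales (simp_all add: mat_1_block[symmetric])
  show ?thesis by (rule injI) (simp add: cp_param_eq_iff moebius_def den_def pairing_simps)
qed

context chart_change begin

lemma cp_transition_eq:
  assumes "den z \<noteq> 0"
  shows "cp_transition \<sigma> \<alpha> \<beta> z = moebius z"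
proof -
  have "cp_param \<sigma> \<alpha> z = cp_param \<sigma> \<beta> (moebius z)" using assms cp_param_eq_iff by blast
  then show ?thesis by (simp add: cp_transition_def cp_chart_def inv_f_f[OF inj_cp_param[OF sigma]])
qed

lemma sigma_cancel: "\<sigma> \<beta> ** A = \<sigma> \<beta> ** B \<longleftrightarrow> A = B"
proof
  assume "\<sigma> \<beta> ** A = \<sigma> \<beta> ** B"
  then have "matrix_inv (\<sigma> \<beta>) ** (\<sigma> \<beta> ** A) = matrix_inv (\<sigma> \<beta>) ** (\<sigma> \<beta> ** B)" by simp
  then show "A = B" by (simp add: matrix_mul_assoc sigma_inverse[OF sigma])
qed simp

lemma factorisation_sigma:
  assumes "den (z_part p) \<noteq> 0"
  shows "\<sigma> \<beta> ** u_plus (moebius (z_part p)) **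
      u_minus ((c + den (z_part p) *s w_part s p) v* schur_inverse (z_part p)) = h_matrix \<sigma> s \<alpha> p ** levi (z_part p)"
  unfolding h_matrix_def transition matrix_mul_assoc[symmetric] sigma_cancel
  by (simp add: factorisation[OF assms, symmetric] matrix_mul_assoc)

text \<open>
  All other factors in the factorisation have determinant one, so \<open>levi\<close> lies in \<open>SL\<close> without computing the
  determinant of its upper block.
\<close>

lemma t_cocycle_eq:
  assumes "den (z_part p) \<noteq> 0"
  shows "t_cocycle \<sigma> s \<alpha> \<beta> p = levi (z_part p)"
  unfolding t_cocycle_def cp_transition_eq[OF assms]
proof (rule the_equality)
  have "det (\<sigma> \<alpha>) = 1" "det (\<sigma> \<beta>) = 1" using sigma by (auto simp: admissible_sigma_def SL_def)
  with arg_cong[OF factorisation_sigma[OF assms], of det] have "det (levi (z_part p)) = 1"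
    by (simp add: det_mul det_u_plus det_u_minus h_matrix_def)
  then have "levi (z_part p) \<in> Levi" by (auto simp: Levi_def SL_def levi_def)
  then show "levi (z_part p) \<in> Levi \<and> (\<exists>w. \<sigma> \<beta> ** u_plus (moebius (z_part p)) ** u_minus w
      = h_matrix \<sigma> s \<alpha> p ** levi (z_part p))"
    using factorisation_sigma[OF assms] by blast
next
  fix t assume "t \<in> Levi \<and> (\<exists>w. \<sigma> \<beta> ** u_plus (moebius (z_part p)) ** u_minus w = h_matrix \<sigma> s \<alpha> p ** t)"
  then obtain x y w where t: "t = block x 0 0 y"
    and eq: "\<sigma> \<beta> ** u_plus (moebius (z_part p)) ** u_minus w = h_matrix \<sigma> s \<alpha> p ** t"
    by (auto simp: Levi_def)
  have "block a b c d ** u_plus (z_part p) ** u_minus (w_part s p) ** block x 0 0 y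
      = u_plus (moebius (z_part p)) ** u_minus w"
    using eq unfolding t h_matrix_def transition matrix_mul_assoc[symmetric] sigma_cancel by simp
  then show "t = levi (z_part p)" unfolding t by (rule factorisation_unique[OF assms])
qed

lemma open_den: "open {z. den z \<noteq> 0}"
proof (rule open_Collect_neq)
  show "continuous_on UNIV den"
    using has_derivative_continuous[OF has_derivative_den] continuous_at_imp_continuous_on by blast
qed (rule continuous_on_const)

lemma frechet_derivative_transition:
  assumes "den z \<noteq> 0"
  shows "frechet_derivative (cp_transition \<sigma> \<alpha> \<beta>) (at z) = (\<lambda>v. (1 / den z) *s (schur z *v v))"
proof (rule frechet_derivative_at[symmetric])
  show "(cp_transition \<sigma> \<alpha> \<beta> has_derivative (\<lambda>v. (1 / den z) *s (schur z *v v))) (at z)"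
    by (rule has_derivative_transform_within_open[OF has_derivative_moebius[OF assms] open_den])
      (use assms in \<open>auto simp: cp_transition_eq\<close>)
qed

lemma frechet_derivative_cocycle:
  assumes "den (z_part p) \<noteq> 0"
  shows "frechet_derivative (t_cocycle \<sigma> s \<alpha> \<beta>) (at p) =
    (\<lambda>v. block (- outer (z_part v) c') 0 0 (- pairing c (z_part v) / (den (z_part p))\<^sup>2))"
proof (rule frechet_derivative_at[symmetric])
  have z: "(z_part has_derivative z_part) (at p)"
    by (rule bounded_linear_imp_has_derivative[OF bounded_linear_z_part])
  have "((\<lambda>p. levi (z_part p)) has_derivative
    (\<lambda>v. block (- outer (z_part v) c') 0 0 (- pairing c (z_part v) / (den (z_part p))\<^sup>2))) (at p)"
    by (rule has_derivative_compose[OF z has_derivative_levi[OF assms]])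
  moreover have "open (z_part -` {z. den z \<noteq> 0})"
    by (intro open_vimage open_den linear_continuous_on bounded_linear_z_part)
  ultimately show "(t_cocycle \<sigma> s \<alpha> \<beta> has_derivative
    (\<lambda>v. block (- outer (z_part v) c') 0 0 (- pairing c (z_part v) / (den (z_part p))\<^sup>2))) (at p)"
    by (rule has_derivative_transform_within_open) (use assms in \<open>auto simp: t_cocycle_eq\<close>)
qed

text \<open>
  With $\xi = -sw$ and $D = cz + d$, the identity of one-forms reads
  $-\frac{s}{D}\,w_\beta(\mathrm{schur}\,z)\,v = -s\,w_\alpha v - \frac{s}{D}\,cv$ for all \<open>v\<close>. Solving it for $w_\beta$
  gives precisely the lower triangular factor of \<open>factorisation\<close>. The twist by $\lambda$ thus
  turns the gluing of cotangent vectors into an identity of matrices.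
\<close>

lemma glue_iff:
  "((\<alpha>, p), (\<beta>, q)) \<in> glue \<sigma> s \<longleftrightarrow> den (z_part p) \<noteq> 0 \<and> z_part q = moebius (z_part p) \<and>
     w_part s q = (c + den (z_part p) *s w_part s p) v* schur_inverse (z_part p)"
proof (cases "den (z_part p) \<noteq> 0")
  case True
  let ?z = "z_part p"
  \<comment> \<open>Both sides of the one-form identity carry the common factor $-s / D$, which cancels.\<close>
  have "(\<forall>v. pairing (xi_part q) ((1 / den ?z) *s (schur ?z *v z_part v))
           = pairing (xi_part p) (z_part v) - s * pairing c (z_part v) / den ?z)
     \<longleftrightarrow> (\<forall>v. pairing (w_part s q v* schur ?z) (z_part v) = pairing (c + den ?z *s w_part s p) (z_part v))"
  proof (intro iff_allI)
    fix v
    have "pairing (xi_part q) ((1 / den ?z) *s (schur ?z *v z_part v))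
       = - (s / den ?z) * pairing (w_part s q v* schur ?z) (z_part v)"
      by (simp add: xi_part_w_part[OF s] pairing_simps pairing_vector_matrix)
    moreover have "pairing (xi_part p) (z_part v) - s * pairing c (z_part v) / den ?z
       = - (s / den ?z) * pairing (c + den ?z *s w_part s p) (z_part v)"
      using True by (simp add: xi_part_w_part[OF s] pairing_simps field_simps)
    ultimately show "pairing (xi_part q) ((1 / den ?z) *s (schur ?z *v z_part v))
           = pairing (xi_part p) (z_part v) - s * pairing c (z_part v) / den ?z \<longleftrightarrow>
       pairing (w_part s q v* schur ?z) (z_part v) = pairing (c + den ?z *s w_part s p) (z_part v)"
      using True s by simp
  qed
  also have "\<dots> \<longleftrightarrow> (\<forall>v. pairing (w_part s q v* schur ?z) v = pairing (c + den ?z *s w_part s p) v)"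
    by (metis vec_split)
  also have "\<dots> \<longleftrightarrow> w_part s q v* schur ?z = c + den ?z *s w_part s p"
    unfolding vec_eq_iff using pairing_axis[where k=1] by (metis mult.right_neutral vec_eq_iff)
  also have "\<dots> \<longleftrightarrow> w_part s q = (c + den ?z *s w_part s p) v* schur_inverse ?z"
    by (metis schur_schur_inverse[OF True] schur_inverse_schur[OF True] vector_matrix_mul_assoc vector_matrix_mul_rid)
  finally show ?thesis using True
    by (simp add: glue_def cp_param_in_U_chart cp_transition_eq frechet_derivative_transition
        frechet_derivative_cocycle t_cocycle_eq lambda_pair_levi pairing_def[symmetric])
qed (simp add: glue_def cp_param_in_U_chart)

end

section \<open>The function $\tau$ is polynomial in every chart\<close>

text \<open>
  $\mu_+$ computed from one representative; \<open>mu_loc_glue\<close> makes it a function on the quotient.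
\<close>

definition mu_loc :: "('n option \<Rightarrow> 'n mat1) \<Rightarrow> complex \<Rightarrow> 'n option \<Rightarrow> 'n cvec \<Rightarrow> ('n::finite) mat1" where
  "mu_loc \<sigma> s \<alpha> p = h_matrix \<sigma> s \<alpha> p ** lambda_dual s ** matrix_inv (h_matrix \<sigma> s \<alpha> p)"

lemma h_matrix_inverse:
  assumes "admissible_sigma \<sigma>"
  shows "h_matrix \<sigma> s \<alpha> p ** (u_minus (- w_part s p) ** u_plus (- z_part p) ** matrix_inv (\<sigma> \<alpha>)) = mat 1"
proof -
  have "h_matrix \<sigma> s \<alpha> p ** (u_minus (- w_part s p) ** u_plus (- z_part p) ** matrix_inv (\<sigma> \<alpha>)) =
    \<sigma> \<alpha> ** (u_plus (z_part p) ** (u_minus (w_part s p) ** u_minus (- w_part s p)) ** u_plus (- z_part p)) ** matrix_inv (\<sigma> \<alpha>)"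
    by (simp add: h_matrix_def matrix_mul_assoc)
  then show ?thesis by (simp add: u_minus_inverse u_plus_inverse sigma_inverse[OF assms])
qed

text \<open>
  $\lambda^\vee$ is scalar on each of the two blocks, so its centraliser contains the block diagonal matrices.
\<close>

lemma conjugation_block_diagonal:
  fixes h h' t' :: "('n::finite) mat1"
  assumes "h ** h' = mat 1" "block x 0 0 y ** t' = mat 1"
  shows "(h ** block x 0 0 y) ** lambda_dual s ** matrix_inv (h ** block x 0 0 y) = h ** lambda_dual s ** matrix_inv h"
proof -
  have inv: "matrix_inv h = h'" by (rule matrix_inv_eqI[OF assms(1)])
  have "(h ** block x 0 0 y) ** (t' ** h') = h ** (block x 0 0 y ** t') ** h'"
    by (simp only: matrix_mul_assoc)
  then have inv': "matrix_inv (h ** block x 0 0 y) = t' ** h'"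
    by (intro matrix_inv_eqI) (simp add: assms)
  have "block x 0 0 y ** lambda_dual s = lambda_dual s ** block x 0 0 y"
    by (simp add: lambda_dual_def block_mult mat_mult_commute outer_simps pairing_simps mult_ac)
  then have "(h ** block x 0 0 y) ** lambda_dual s ** (t' ** h') = h ** lambda_dual s ** (block x 0 0 y ** t') ** h'"
    by (metis matrix_mul_assoc)
  then show ?thesis by (simp add: inv inv' assms)
qed

lemma mu_loc_glue:
  fixes \<sigma> :: "'n::{finite,linorder} option \<Rightarrow> 'n mat1"
  assumes "admissible_sigma \<sigma>" "s \<noteq> 0" "((\<alpha>, p), (\<beta>, q)) \<in> glue \<sigma> s"
  shows "mu_loc \<sigma> s \<beta> q = mu_loc \<sigma> s \<alpha> p"
proof -
  obtain a b c d where M: "matrix_inv (\<sigma> \<beta>) ** \<sigma> \<alpha> = block a b c d" using block_exhaust .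
  obtain a' b' c' d' where M': "matrix_inv (\<sigma> \<alpha>) ** \<sigma> \<beta> = block a' b' c' d'" using block_exhaust .
  have "block a' b' c' d' ** block a b c d = matrix_inv (\<sigma> \<alpha>) ** (\<sigma> \<beta> ** matrix_inv (\<sigma> \<beta>)) ** \<sigma> \<alpha>"
    unfolding M[symmetric] M'[symmetric] by (simp only: matrix_mul_assoc)
  then interpret chart_change a a' b b' c c' d d' \<sigma> s \<alpha> \<beta>
    using assms(1,2)
    by unfold_locales (simp_all add: M[symmetric] matrix_mul_assoc sigma_inverse)
  let ?z = "z_part p"
  from assms(3) have den: "den ?z \<noteq> 0" and q: "z_part q = moebius ?z"
     "w_part s q = (c + den ?z *s w_part s p) v* schur_inverse ?z"
    unfolding glue_iff by auto
  have "h_matrix \<sigma> s \<beta> q = h_matrix \<sigma> s \<alpha> p ** levi ?z"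
    using factorisation_sigma[OF den] by (simp add: h_matrix_def q)
  then show ?thesis
    using conjugation_block_diagonal[OF h_matrix_inverse[OF assms(1)] levi_inverse[OF den, unfolded levi_def]]
    by (simp add: mu_loc_def levi_def)
qed

text \<open>
  Reflexivity makes the image of a class under $\mu_+$ nonempty; together with \<open>mu_loc_glue\<close> it is a singleton.
\<close>

lemma glue_refl:
  fixes \<sigma> :: "'n::{finite,linorder} option \<Rightarrow> 'n mat1"
  assumes "admissible_sigma \<sigma>" "s \<noteq> 0"
  shows "((\<alpha>, p), (\<alpha>, p)) \<in> glue \<sigma> s"
proof -
  interpret chart_change "mat 1" "mat 1" 0 0 0 0 1 1 \<sigma> s \<alpha> \<alpha>
    using assms by unfold_locales (simp_all add: mat_1_block[symmetric])
  show ?thesis unfolding glue_iff by (simp add: den_def moebius_def schur_inverse_def pairing_simps outer_simps)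
qed

lemma tau_loc_eq:
  fixes \<sigma> :: "'n::{finite,linorder} option \<Rightarrow> 'n mat1"
  assumes "admissible_sigma \<sigma>" "s \<noteq> 0"
  shows "tau_loc \<sigma> s \<alpha> p = Re (trace (mu_loc \<sigma> s \<alpha> p ** conj_transpose (mu_loc \<sigma> s \<alpha> p)))
     + (cmod s)\<^sup>2 / (real CARD('n) + 1)"
proof -
  have "(\<lambda>(\<beta>, q). mu_loc \<sigma> s \<beta> q) ` chart_point \<sigma> s \<alpha> p = {mu_loc \<sigma> s \<alpha> p}"
    using glue_refl[OF assms, of \<alpha> p] mu_loc_glue[OF assms, of \<alpha> p] unfolding chart_point_def by fast
  then show ?thesis by (simp add: tau_loc_def tau_def mu_plus_def mu_loc_def)
qed

text \<open>
  Real polynomials rather than complex ones, because the class has to be closed under conjugation.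
\<close>

definition complex_polynomial :: "('a::real_normed_vector \<Rightarrow> complex) \<Rightarrow> bool" where
  "complex_polynomial g \<longleftrightarrow>
     real_polynomial_function (\<lambda>x. Re (g x)) \<and> real_polynomial_function (\<lambda>x. Im (g x))"

lemma complex_polynomial_const: "complex_polynomial (\<lambda>x. k)"
  by (auto simp: complex_polynomial_def)

lemma complex_polynomial_mult:
  "complex_polynomial f \<Longrightarrow> complex_polynomial g \<Longrightarrow> complex_polynomial (\<lambda>x. f x * g x)"
  by (auto simp: complex_polynomial_def)

lemma complex_polynomial_sum:
  "finite A \<Longrightarrow> (\<And>i. i \<in> A \<Longrightarrow> complex_polynomial (f i)) \<Longrightarrow> complex_polynomial (\<lambda>x. \<Sum>i\<in>A. f i x)"
  by (auto simp: complex_polynomial_def Re_sum Im_sum)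

lemma complex_polynomial_minus: "complex_polynomial f \<Longrightarrow> complex_polynomial (\<lambda>x. - f x)"
  by (auto simp: complex_polynomial_def)

lemma complex_polynomial_cnj: "complex_polynomial f \<Longrightarrow> complex_polynomial (\<lambda>x. cnj (f x))"
  by (auto simp: complex_polynomial_def)

lemma complex_polynomial_nth: "complex_polynomial (\<lambda>p::complex ^ 'm. p $ i)"
  unfolding complex_polynomial_def
  by (intro conjI real_polynomial_function.intros(1) bounded_linear_compose[OF bounded_linear_Re]
      bounded_linear_compose[OF bounded_linear_Im] bounded_linear_vec_nth)

definition matrix_polynomial :: "('a::real_normed_vector \<Rightarrow> complex ^ 'm ^ 'm) \<Rightarrow> bool" where
  "matrix_polynomial F \<longleftrightarrow> (\<forall>i j. complex_polynomial (\<lambda>p. F p $ i $ j))"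

lemma matrix_polynomial_const: "matrix_polynomial (\<lambda>p. M)"
  by (simp add: matrix_polynomial_def complex_polynomial_const)

lemma matrix_polynomial_mult:
  "matrix_polynomial F \<Longrightarrow> matrix_polynomial G \<Longrightarrow> matrix_polynomial (\<lambda>p. F p ** G p)"
  unfolding matrix_polynomial_def matrix_matrix_mult_def
  by (auto intro!: complex_polynomial_sum complex_polynomial_mult)

lemma matrix_polynomial_conj_transpose:
  "matrix_polynomial F \<Longrightarrow> matrix_polynomial (\<lambda>p. conj_transpose (F p))"
  unfolding matrix_polynomial_def conj_transpose_def by (auto intro!: complex_polynomial_cnj)

lemma matrix_polynomial_trace: "matrix_polynomial F \<Longrightarrow> complex_polynomial (\<lambda>p. trace (F p))"
  unfolding matrix_polynomial_def trace_def by (auto intro!: complex_polynomial_sum)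

lemma matrix_polynomial_u_plus:
  assumes "\<And>i. complex_polynomial (\<lambda>p. z p $ i)"
  shows "matrix_polynomial (\<lambda>p. u_plus (z p))"
  unfolding matrix_polynomial_def
proof (intro allI)
  fix i j show "complex_polynomial (\<lambda>p. u_plus (z p) $ i $ j)"
    by (cases i; cases j) (simp_all add: u_plus_def block_def complex_polynomial_const assms)
qed

lemma matrix_polynomial_u_minus:
  assumes "\<And>i. complex_polynomial (\<lambda>p. z p $ i)"
  shows "matrix_polynomial (\<lambda>p. u_minus (z p))"
  unfolding matrix_polynomial_def
proof (intro allI)
  fix i j show "complex_polynomial (\<lambda>p. u_minus (z p) $ i $ j)"
    by (cases i; cases j) (simp_all add: u_minus_def block_def complex_polynomial_const assms)
qed

lemma real_polynomial_tau_loc: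
  fixes \<sigma> :: "'n::{finite,linorder} option \<Rightarrow> 'n mat1"
  assumes "admissible_sigma \<sigma>" "s \<noteq> 0"
  shows "real_polynomial_function (tau_loc \<sigma> s \<alpha>)"
proof -
  have z: "complex_polynomial (\<lambda>p. z_part p $ i)" for i :: 'n
    by (simp add: z_part_def complex_polynomial_nth)
  have w: "complex_polynomial (\<lambda>p. w_part s p $ i)" for i :: 'n
    using complex_polynomial_mult[OF complex_polynomial_const[of "- 1 / s"] complex_polynomial_nth[of "Inr i"]]
    by (simp add: w_part_def xi_part_def)
  have zw: "complex_polynomial (\<lambda>p. (- z_part p) $ i)" "complex_polynomial (\<lambda>p. (- w_part s p) $ i)" for i :: 'n
    using complex_polynomial_minus[OF z] complex_polynomial_minus[OF w] by simp_all
  have "mu_loc \<sigma> s \<alpha> = (\<lambda>p. h_matrix \<sigma> s \<alpha> p ** lambda_dual s **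
      (u_minus (- w_part s p) ** u_plus (- z_part p) ** matrix_inv (\<sigma> \<alpha>)))"
    unfolding mu_loc_def[abs_def] matrix_inv_eqI[OF h_matrix_inverse[OF assms(1)]] ..
  then have "matrix_polynomial (mu_loc \<sigma> s \<alpha>)"
    unfolding h_matrix_def
    by (simp only:) (intro matrix_polynomial_mult matrix_polynomial_u_plus matrix_polynomial_u_minus
        matrix_polynomial_const z w zw)
  then have "complex_polynomial (\<lambda>p. trace (mu_loc \<sigma> s \<alpha> p ** conj_transpose (mu_loc \<sigma> s \<alpha> p)))"
    by (intro matrix_polynomial_trace matrix_polynomial_mult matrix_polynomial_conj_transpose)
  then show ?thesis
    unfolding tau_loc_eq[OF assms, abs_def] complex_polynomial_def by auto
qed

section \<open>Closed real forms of type (1,1)\<close>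

text \<open>
  The sum and product rules produce the second derivative and its symmetry in the same induction.
\<close>

lemma real_polynomial_function_second_derivative:
  fixes g :: "'a::real_normed_vector \<Rightarrow> real"
  assumes "real_polynomial_function g"
  shows "\<exists>g' g''. (\<forall>q. (g has_derivative g' q) (at q)) \<and>
    (\<forall>q v. ((\<lambda>q. g' q v) has_derivative (\<lambda>u. g'' q u v)) (at q)) \<and>
    (\<forall>q u v. g'' q u v = g'' q v u)"
  using assms
proof induction
  case (linear f)
  show ?case
    by (rule exI[of _ "\<lambda>q v. f v"], rule exI[of _ "\<lambda>q u v. 0"])
      (simp add: bounded_linear_imp_has_derivative[OF linear])
next
  case (const c)
  show ?case
    by (rule exI[of _ "\<lambda>q v. 0"], rule exI[of _ "\<lambda>q u v. 0"]) simp
next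
  case (add f g)
  obtain f' f'' where f: "\<And>q. (f has_derivative f' q) (at q)"
    "\<And>q v. ((\<lambda>q. f' q v) has_derivative (\<lambda>u. f'' q u v)) (at q)" "\<And>q u v. f'' q u v = f'' q v u"
    using add.IH(1) by metis
  obtain g' g'' where g: "\<And>q. (g has_derivative g' q) (at q)"
    "\<And>q v. ((\<lambda>q. g' q v) has_derivative (\<lambda>u. g'' q u v)) (at q)" "\<And>q u v. g'' q u v = g'' q v u"
    using add.IH(2) by metis
  show ?case
  proof (rule exI[of _ "\<lambda>q v. f' q v + g' q v"], rule exI[of _ "\<lambda>q u v. f'' q u v + g'' q u v"],
      intro conjI allI)
    show "((\<lambda>x. f x + g x) has_derivative (\<lambda>v. f' q v + g' q v)) (at q)" for q
      by (rule has_derivative_add[OF f(1) g(1)])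
    show "((\<lambda>q. f' q v + g' q v) has_derivative (\<lambda>u. f'' q u v + g'' q u v)) (at q)" for q v
      by (rule has_derivative_add[OF f(2) g(2)])
    show "f'' q u v + g'' q u v = f'' q v u + g'' q v u" for q u v
      by (simp only: f(3)[of q u v] g(3)[of q u v])
  qed
next
  case (mult f g)
  obtain f' f'' where f: "\<And>q. (f has_derivative f' q) (at q)"
    "\<And>q v. ((\<lambda>q. f' q v) has_derivative (\<lambda>u. f'' q u v)) (at q)" "\<And>q u v. f'' q u v = f'' q v u"
    using mult.IH(1) by metis
  obtain g' g'' where g: "\<And>q. (g has_derivative g' q) (at q)"
    "\<And>q v. ((\<lambda>q. g' q v) has_derivative (\<lambda>u. g'' q u v)) (at q)" "\<And>q u v. g'' q u v = g'' q v u"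
    using mult.IH(2) by metis
  let ?h' = "\<lambda>q v. f q * g' q v + f' q v * g q"
  let ?h'' = "\<lambda>q u v. (f q * g'' q u v + f' q u * g' q v) + (f' q v * g' q u + f'' q u v * g q)"
  show ?case
  proof (rule exI[of _ ?h'], rule exI[of _ ?h''], intro conjI allI)
    show "((\<lambda>x. f x * g x) has_derivative (\<lambda>v. ?h' q v)) (at q)" for q
      by (rule has_derivative_mult[OF f(1) g(1)])
    show "((\<lambda>q. ?h' q v) has_derivative (\<lambda>u. ?h'' q u v)) (at q)" for q v
      by (rule has_derivative_add[OF has_derivative_mult[OF f(1) g(2)] has_derivative_mult[OF f(2) g(1)]])
    show "?h'' q u v = ?h'' q v u" for q u v
      by (simp only: f(3)[of q u v] g(3)[of q u v])
  qed
qed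

lemma I_struct_axis: "I_struct (axis i k) = axis i (\<i> * k)"
  by (simp add: I_struct_def vec_eq_iff axis_def)

lemma axis_complex: "axis i k = Re k *\<^sub>R axis i 1 + Im k *\<^sub>R axis i \<i>"
  by (simp add: vec_eq_iff axis_def complex_eq_iff)

lemma sum_axis: "(\<Sum>i\<in>UNIV. axis i (v $ i)) = v"
  by (simp add: vec_eq_iff axis_def if_distrib cong: if_cong)

text \<open>
  Because of the factor $\sqrt{-1}$ the potential one-form of $\omega_I$ is real, and the Wirtinger derivatives
  disappear from its exterior derivative.
\<close>

lemma delbar_minus_del:
  assumes "(g has_derivative g') (at p)"
  shows "delbar g p v - del g p v = \<i> * of_real (g' (I_struct v))"
proof -
  interpret bounded_linear g' using assms by (rule has_derivative_bounded_linear)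
  have g': "frechet_derivative g (at p) = g'" using frechet_derivative_at[OF assms] by simp
  have "g' (I_struct v) = g' (\<Sum>i\<in>UNIV. axis i (\<i> * v $ i))"
    using sum_axis[of "I_struct v"] by (simp add: I_struct_def)
  also have "\<dots> = (\<Sum>i\<in>UNIV. g' (axis i (\<i> * v $ i)))" by (rule sum)
  also have "\<dots> = (\<Sum>i\<in>UNIV. Re (v $ i) * g' (axis i \<i>) - Im (v $ i) * g' (axis i 1))"
    by (subst axis_complex) (simp add: add scaleR diff)
  finally have "\<i> * of_real (g' (I_struct v))
      = (\<Sum>i\<in>UNIV. \<i> * (of_real (Re (v $ i)) * of_real (g' (axis i \<i>)) - of_real (Im (v $ i)) * of_real (g' (axis i 1))))"
    by (simp add: sum_distrib_left)
  also have "\<dots> = delbar g p v - del g p v"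
    unfolding delbar_def del_def sum_subtractf[symmetric] wirtinger_def wirtinger_bar_def g' dz_def dzbar_def
    by (intro sum.cong refl) (simp add: complex_eq_iff field_simps)
  finally show ?thesis by simp
qed

definition hermitian_pairing :: "complex ^ 'm ^ 'm \<Rightarrow> complex ^ 'm \<Rightarrow> complex ^ 'm \<Rightarrow> complex" where
  "hermitian_pairing g u v = (\<Sum>i\<in>UNIV. \<Sum>j\<in>UNIV. g $ i $ j * (u $ i * cnj (v $ j)))"

lemma sum_wedge:
  "(\<Sum>i\<in>UNIV. \<Sum>j\<in>UNIV. g $ i $ j * wedge (dz i) (dzbar j) u v) =
     hermitian_pairing g u v - hermitian_pairing g v u"
  by (simp add: hermitian_pairing_def wedge_def dz_def dzbar_def algebra_simps sum_subtractf)

lemma hermitian_pairing_axis: "hermitian_pairing g (axis k a) (axis l b) = g $ k $ l * a * cnj b"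
proof -
  have "g $ i $ j * (axis k a $ i * cnj (axis l b $ j)) =
      (if j = l then if i = k then g $ k $ l * a * cnj b else 0 else 0)" for i j
    by (simp add: axis_def)
  then show ?thesis by (simp add: hermitian_pairing_def)
qed

lemma hermitian_pairing_swap:
  assumes "conj_transpose g = g"
  shows "hermitian_pairing g v u = cnj (hermitian_pairing g u v)"
proof -
  have g: "cnj (g $ i $ j) = g $ j $ i" for i j
    using arg_cong[OF assms, of "\<lambda>M. M $ j $ i"] by (simp add: conj_transpose_def)
  have "hermitian_pairing g v u = (\<Sum>j\<in>UNIV. \<Sum>i\<in>UNIV. g $ i $ j * (v $ i * cnj (u $ j)))"
    unfolding hermitian_pairing_def by (rule sum.swap)
  also have "\<dots> = cnj (hermitian_pairing g u v)"
    unfolding hermitian_pairing_def cnj_sum complex_cnj_mult complex_cnj_cnj g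
    by (intro sum.cong refl) (simp only: mult_ac)
  finally show ?thesis .
qed

text \<open>
  The pairs $(e_k, e_l)$ and $(e_k, \sqrt{-1}\,e_l)$ recover the difference and the sum of $g_{k\bar l}$ and $g_{l\bar k}$.
\<close>

lemma components_unique:
  assumes "\<And>u v. hermitian_pairing g u v - hermitian_pairing g v u
      = hermitian_pairing h u v - hermitian_pairing h v u"
  shows "g = h"
proof -
  have "g $ k $ l = h $ k $ l" for k l
    using assms[of "axis k 1" "axis l 1"] assms[of "axis k 1" "axis l \<i>"]
    by (simp add: hermitian_pairing_axis complex_eq_iff)
  then show ?thesis by (simp add: vec_eq_iff)
qed

text \<open>
  The matrix is read off from $H(u, v) = \omega(u, Iv) - \sqrt{-1}\,\omega(u, v)$, which is
  linear in \<open>u\<close> and conjugate-linear in \<open>v\<close> because \<open>I\<close> preserves $\omega$.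
\<close>

lemma one_one_form_components:
  fixes \<omega> :: "complex ^ 'm \<Rightarrow> complex ^ 'm \<Rightarrow> real"
  assumes bil: "bilinear \<omega>" and alt: "\<And>u v. \<omega> v u = - \<omega> u v"
    and inv: "\<And>u v. \<omega> (I_struct u) (I_struct v) = \<omega> u v"
  obtains g where "conj_transpose g = g" "\<And>u v. \<omega> u v = - Im (hermitian_pairing g u v)"
proof
  define g :: "complex ^ 'm ^ 'm" where
    "g = (\<chi> i j. Complex (\<omega> (axis i 1) (axis j \<i>)) (- \<omega> (axis i 1) (axis j 1)))"
  \<comment> \<open>Invariance determines all four real products of two coordinate directions from two of them.\<close>
  have ii: "\<omega> (axis i \<i>) (axis j \<i>) = \<omega> (axis i 1) (axis j 1)" for i j
    using inv[of "axis i 1" "axis j 1"] by (simp add: I_struct_axis)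
  have "axis j (- 1) = - axis j (1::complex)" for j :: 'm
    by (simp add: axis_def vec_eq_iff)
  then have i1: "\<omega> (axis i \<i>) (axis j 1) = - \<omega> (axis i 1) (axis j \<i>)" for i j
    using inv[of "axis i 1" "axis j \<i>"] by (simp add: I_struct_axis bilinear_rneg[OF bil])
  have "cnj (g $ j $ i) = g $ i $ j" for i j
    using alt[of "axis i \<i>" "axis j 1"] i1[of i j] alt[of "axis i 1" "axis j 1"]
    by (simp add: g_def complex_eq_iff)
  then show "conj_transpose g = g"
    by (simp add: conj_transpose_def vec_eq_iff)
  fix u v
  have entry: "\<omega> (axis i a) (axis j b) = - Im (g $ i $ j * (a * cnj b))" for i j a b
    unfolding axis_complex[of i a] axis_complex[of j b]
    by (simp add: bilinear_ladd[OF bil] bilinear_radd[OF bil] bilinear_lmul[OF bil] bilinear_rmul[OF bil]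
        ii i1 g_def algebra_simps)
  have "\<omega> u v = \<omega> (\<Sum>i\<in>UNIV. axis i (u $ i)) (\<Sum>j\<in>UNIV. axis j (v $ j))" by (simp only: sum_axis)
  also have "\<dots> = (\<Sum>(i, j)\<in>UNIV \<times> UNIV. \<omega> (axis i (u $ i)) (axis j (v $ j)))"
    by (rule bilinear_sum[OF bil])
  also have "\<dots> = (\<Sum>i\<in>UNIV. \<Sum>j\<in>UNIV. - Im (g $ i $ j * (u $ i * cnj (v $ j))))"
    by (simp only: sum.cartesian_product entry)
  also have "\<dots> = - Im (hermitian_pairing g u v)"
    by (simp only: hermitian_pairing_def Im_sum sum_negf)
  finally show "\<omega> u v = - Im (hermitian_pairing g u v)" .
qed

lemma the_components:
  assumes "conj_transpose g = g" "\<And>u v. \<omega> u v = - Im (hermitian_pairing g u v)"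
  shows "(THE g. \<forall>u v. of_real (\<omega> u v) =
      \<i> / 2 * (\<Sum>i\<in>UNIV. \<Sum>j\<in>UNIV. g $ i $ j * wedge (dz i) (dzbar j) u v)) = g"
  unfolding sum_wedge
proof (rule the_equality)
  show *: "\<forall>u v. of_real (\<omega> u v) = \<i> / 2 * (hermitian_pairing g u v - hermitian_pairing g v u)"
    by (intro allI, subst (2) hermitian_pairing_swap[OF assms(1)])
      (simp add: assms(2) complex_eq_iff)
  fix h assume "\<forall>u v. of_real (\<omega> u v) = \<i> / 2 * (hermitian_pairing h u v - hermitian_pairing h v u)"
  with * have "\<i> / 2 * (hermitian_pairing h u v - hermitian_pairing h v u)
      = \<i> / 2 * (hermitian_pairing g u v - hermitian_pairing g v u)" for u v
    by simp
  then show "h = g" by (intro components_unique) simp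
qed

lemma I_struct_simps:
  "I_struct (u + v) = I_struct u + I_struct v" "I_struct (r *\<^sub>R u) = r *\<^sub>R I_struct u"
  "I_struct (I_struct v) = - v"
  by (simp_all add: I_struct_def vec_eq_iff algebra_simps)

lemma ddc_form_formula:
  fixes \<tau> :: "complex ^ 'm \<Rightarrow> real"
  assumes f: "\<And>x. f field_differentiable (at x)"
    and \<tau>: "\<And>q. (\<tau> has_derivative \<tau>' q) (at q)"
      "\<And>q v. ((\<lambda>q. \<tau>' q v) has_derivative (\<lambda>u. \<tau>'' q u v)) (at q)"
  shows "Re (ext_deriv (\<lambda>q x. \<i> / 4 * of_real (f (\<tau> q)) * (delbar \<tau> q x - del \<tau> q x)) p u v) =
    - (1 / 4) * (deriv f (\<tau> p) * (\<tau>' p u * \<tau>' p (I_struct v) - \<tau>' p v * \<tau>' p (I_struct u))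
      + f (\<tau> p) * (\<tau>'' p u (I_struct v) - \<tau>'' p v (I_struct u)))"
proof -
  let ?D = "\<lambda>u v. - (1 / 4) * (f (\<tau> p) * \<tau>'' p u (I_struct v) + deriv f (\<tau> p) * \<tau>' p u * \<tau>' p (I_struct v))"
  have f': "(f has_derivative (\<lambda>h. deriv f x * h)) (at x)" for x
    using f[of x] by (simp add: has_field_derivative_def[symmetric] field_differentiable_derivI)
  have "((\<lambda>q. - (1 / 4) * (f (\<tau> q) * \<tau>' q (I_struct v))) has_derivative (\<lambda>u. ?D u v)) (at p)" for v
    by (rule has_derivative_mult_right[OF has_derivative_mult[OF has_derivative_compose[OF \<tau>(1) f'] \<tau>(2)]])
  then have "((\<lambda>q. of_real (- (1 / 4) * (f (\<tau> q) * \<tau>' q (I_struct v)))) has_derivative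
      (\<lambda>u. complex_of_real (?D u v))) (at p)" for v
    by (rule has_derivative_of_real)
  moreover have "\<i> / 4 * of_real (f (\<tau> q)) * (delbar \<tau> q v - del \<tau> q v)
      = complex_of_real (- (1 / 4) * (f (\<tau> q) * \<tau>' q (I_struct v)))" for q v
    by (simp add: delbar_minus_del[OF \<tau>(1)] complex_eq_iff)
  ultimately have "frechet_derivative (\<lambda>q. \<i> / 4 * of_real (f (\<tau> q)) * (delbar \<tau> q v - del \<tau> q v)) (at p)
      = (\<lambda>u. complex_of_real (?D u v))" for v
    by (intro frechet_derivative_at[symmetric]) (simp only:)
  then show ?thesis
    unfolding ext_deriv_def by (simp add: algebra_simps)
qed

text \<open>
  Applying \<open>I\<close> to both arguments exchanges the two terms of each difference in the formula above. The terms with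
  the second derivative come back with their arguments swapped, and this is where its symmetry enters.
\<close>

lemma ddc_form_one_one:
  fixes \<tau> :: "complex ^ 'm \<Rightarrow> real" and p :: "complex ^ 'm"
  assumes f: "\<And>x. f field_differentiable (at x)" and poly: "real_polynomial_function \<tau>"
  defines "\<omega> \<equiv> \<lambda>u v. Re (ext_deriv (\<lambda>q x. \<i> / 4 * of_real (f (\<tau> q)) * (delbar \<tau> q x - del \<tau> q x)) p u v)"
  shows "bilinear \<omega>" "\<omega> v u = - \<omega> u v" "\<omega> (I_struct u) (I_struct v) = \<omega> u v"
proof -
  obtain \<tau>' \<tau>'' where \<tau>: "\<And>q. (\<tau> has_derivative \<tau>' q) (at q)"
    "\<And>q v. ((\<lambda>q. \<tau>' q v) has_derivative (\<lambda>u. \<tau>'' q u v)) (at q)"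
    and sym: "\<And>q u v. \<tau>'' q u v = \<tau>'' q v u"
    using real_polynomial_function_second_derivative[OF poly] by metis
  have \<omega>: "\<omega> u v = - (1 / 4) * (deriv f (\<tau> p) * (\<tau>' p u * \<tau>' p (I_struct v) - \<tau>' p v * \<tau>' p (I_struct u))
      + f (\<tau> p) * (\<tau>'' p u (I_struct v) - \<tau>'' p v (I_struct u)))" for u v
    unfolding \<omega>_def by (rule ddc_form_formula[OF f \<tau>])
  have lin: "linear (\<tau>' p)" "linear (\<lambda>u. \<tau>'' p u v)" for v
    using \<tau> has_derivative_linear by blast+
  have lin2: "linear (\<lambda>v. \<tau>'' p u v)" for u
    unfolding sym[of p u] by (rule lin)
  note D = linear_add[OF lin(1)] linear_add[OF lin(2)] linear_add[OF lin2]
    linear_scale[OF lin(1)] linear_scale[OF lin(2)] linear_scale[OF lin2]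
    linear_neg[OF lin(1)] linear_neg[OF lin(2)] linear_neg[OF lin2]
  show "bilinear \<omega>"
    unfolding bilinear_def \<omega> by (intro conjI allI linearI) (simp_all add: I_struct_simps D algebra_simps)
  show "\<omega> v u = - \<omega> u v" by (simp add: \<omega> algebra_simps)
  show "\<omega> (I_struct u) (I_struct v) = \<omega> u v"
    by (simp add: \<omega> I_struct_simps D sym[of p "I_struct u" v] sym[of p "I_struct v" u] algebra_simps)
qed

section \<open>Quaternionic endomorphisms and symplectic matrices\<close>

lemma hermitian_pairing_diff:
  "hermitian_pairing g (u - v) w = hermitian_pairing g u w - hermitian_pairing g v w"
  by (simp add: hermitian_pairing_def algebra_simps sum_subtractf)

definition vcnj :: "complex ^ 'm \<Rightarrow> complex ^ 'm" where
  "vcnj v = (\<chi> i. cnj (v $ i))"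

definition mcnj :: "complex ^ 'm ^ 'm \<Rightarrow> complex ^ 'm ^ 'm" where
  "mcnj A = (\<chi> i j. cnj (A $ i $ j))"

lemma vcnj_simps: "vcnj (vcnj v) = v" "vcnj (k *s v) = cnj k *s vcnj v"
  "vcnj (A *v v) = mcnj A *v vcnj v"
  by (simp_all add: vcnj_def mcnj_def vec_eq_iff matrix_vector_mult_def)

lemma mcnj_simps: "mcnj (mcnj A) = A" "mcnj (A ** B) = mcnj A ** mcnj B"
  by (simp_all add: mcnj_def vec_eq_iff matrix_matrix_mult_def)

lemma pairing_cnj: "pairing (vcnj u) (vcnj v) = cnj (pairing u v)"
  by (simp add: pairing_def vcnj_def)

lemma hermitian_pairing_matrix: "hermitian_pairing g u v = pairing u (g *v vcnj v)"
  by (simp add: hermitian_pairing_def pairing_def matrix_vector_mult_def vcnj_def sum_distrib_left mult_ac)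

lemma conj_transpose_mcnj: "conj_transpose A = mcnj (transpose A)"
  by (simp add: conj_transpose_def mcnj_def transpose_def)

lemma sum_sum_type: "(\<Sum>i\<in>UNIV. g i) = (\<Sum>i\<in>UNIV. g (Inl (i::'n::finite))) + (\<Sum>i\<in>UNIV. g (Inr (i::'k::finite)))"
  using sum.Plus[of "UNIV::'n set" "UNIV::'k set" g] by (simp add: UNIV_Plus_UNIV comp_def)

lemma forall_sum_type: "(\<forall>i. P i) \<longleftrightarrow> (\<forall>i. P (Inl i)) \<and> (\<forall>i. P (Inr i))"
  by (metis sum.exhaust)

lemma S_matrix_vector:
  "(S_matrix *v v) $ Inl i = v $ Inr i" "(S_matrix *v v) $ Inr i = - v $ Inl i"
  by (simp_all add: S_matrix_def matrix_vector_mult_def sum_sum_type if_distrib if_distribR sum_negf cong: if_cong)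

lemma S_matrix_square: "S_matrix *v (S_matrix *v v) = - v"
  by (simp add: vec_eq_iff forall_sum_type S_matrix_vector)

lemma S_matrix_mult_S_matrix: "S_matrix ** S_matrix = - mat 1"
  unfolding matrix_eq by (simp add: matrix_vector_mul_assoc[symmetric] S_matrix_square matrix_vector_minus)

lemma mcnj_S_matrix: "mcnj S_matrix = S_matrix"
  by (auto simp: mcnj_def S_matrix_def vec_eq_iff forall_sum_type)

lemma omega_plus_eq: "omega_plus u v = pairing u (S_matrix *v v)"
  by (simp add: omega_plus_def pairing_def wedge_def dz_def sum_sum_type S_matrix_vector sum_subtractf sum_negf mult_ac)

lemma pairing_S_matrix: "pairing (S_matrix *v u) (S_matrix *v v) = pairing u v"
  by (simp add: pairing_def sum_sum_type S_matrix_vector)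

text \<open>
  The test vector $v = -S\bar u$ turns $\omega_+(u, v)$ into $\|u\|^2$.
\<close>

lemma omega_J_nondegenerate:
  assumes "\<And>v. omega_J u v = 0"
  shows "u = 0"
proof -
  have "Re (pairing u (vcnj u)) = 0"
    using assms[of "- (S_matrix *v vcnj u)"]
    by (simp add: omega_J_def omega_plus_eq matrix_vector_minus S_matrix_square)
  then have "(\<Sum>i\<in>UNIV. (cmod (u $ i))\<^sup>2) = 0"
    by (simp add: pairing_def vcnj_def complex_mult_cnj cmod_power2)
  then show "u = 0" by (simp add: sum_nonneg_eq_0_iff vec_eq_iff)
qed

lemma inj_flat_omega_J: "inj (flat omega_J)"
proof (rule injI)
  fix x y :: "('n::finite) cvec" assume "flat omega_J x = flat omega_J y"
  then have "omega_J x v = omega_J y v" for v by (metis flat_def)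
  then have "omega_J (x - y) v = 0" for v
    by (simp add: omega_J_def omega_plus_eq pairing_simps)
  then show "x = y" using omega_J_nondegenerate[of "x - y"] by simp
qed

text \<open>
  $\omega_+$ is complex bilinear, so replacing \<open>u\<close> by \<open>I u\<close> multiplies it by $\sqrt{-1}$. This links \<open>J\<close> to \<open>K\<close>.
\<close>

lemma omega_J_I_struct: "omega_J (I_struct u) v = - omega_K u v"
  by (simp add: omega_J_def omega_K_def omega_plus_eq I_struct_def pairing_simps)

lemma omega_J_minus: "omega_J (- u) v = - omega_J u v"
  by (simp add: omega_J_def omega_plus_eq pairing_simps)

lemma mcnj_hermitian: "conj_transpose A = A \<Longrightarrow> mcnj A = transpose A"
  by (metis conj_transpose_mcnj mcnj_simps(1))

text \<open>
  The solution $-\sqrt{-1}\,S A\bar u$ of $\omega_J(Ku, \cdot) = \omega_I(u, \cdot)$ for the Hermitian matrix \<open>A\<close> of $\omega_I$.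
\<close>

definition K_map :: "complex ^ ('n + 'n) ^ ('n + 'n) \<Rightarrow> 'n cvec \<Rightarrow> ('n::finite) cvec" where
  "K_map A u = (- \<i>) *s (S_matrix *v (A *v vcnj u))"

lemma omega_J_K_map:
  assumes "conj_transpose A = A"
  shows "omega_J (K_map A u) v = - Im (hermitian_pairing A u v)"
proof -
  have "omega_J (K_map A u) v = Im (pairing (A *v vcnj u) v)"
    by (simp add: omega_J_def omega_plus_eq K_map_def pairing_simps pairing_S_matrix)
  also have "pairing (A *v vcnj u) v = pairing (vcnj u v* mcnj A) v"
    unfolding mcnj_hermitian[OF assms] by simp
  also have "\<dots> = cnj (hermitian_pairing A u v)"
    by (simp add: pairing_vector_matrix hermitian_pairing_matrix pairing_cnj[symmetric] vcnj_simps)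
  finally show ?thesis by simp
qed

lemma K_map_scale: "K_map A (k *s u) = cnj k *s K_map A u"
  by (simp add: K_map_def vcnj_simps vector_scalar_commute mult.commute)

lemma K_map_K_map: "K_map A (K_map A u) = (S_matrix ** A ** S_matrix ** mcnj A) *v u"
proof -
  have "K_map A (K_map A u) = cnj (- \<i>) *s K_map A (S_matrix *v (A *v vcnj u))"
    unfolding K_map_def[of A u] K_map_scale ..
  also have "\<dots> = S_matrix *v (A *v (S_matrix *v (mcnj A *v u)))"
    unfolding K_map_def vcnj_simps mcnj_S_matrix by (simp add: vector_smult_assoc)
  finally show ?thesis by (simp only: matrix_vector_mul_assoc matrix_mul_assoc)
qed

lemma K_map_minus: "K_map A (- u) = - K_map A u"
  using K_map_scale[of A "- 1" u] by simp

lemma K_map_square_iff: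
  assumes "conj_transpose A = A"
  shows "(\<forall>u. K_map A (K_map A u) = - u) \<longleftrightarrow>
    transpose A ** S_matrix ** A = S_matrix"
proof -
  have "(\<forall>u. K_map A (K_map A u) = - u) \<longleftrightarrow> S_matrix ** A ** S_matrix ** mcnj A = - mat 1"
    unfolding matrix_eq by (simp add: K_map_K_map matrix_vector_minus)
  also have "\<dots> \<longleftrightarrow> A ** S_matrix ** mcnj A = S_matrix"
  proof
    assume "S_matrix ** A ** S_matrix ** mcnj A = - mat 1"
    then have "S_matrix ** (S_matrix ** A ** S_matrix ** mcnj A) = - S_matrix"
      by (simp add: matrix_mult_distrib)
    then show "A ** S_matrix ** mcnj A = S_matrix"
      by (simp add: matrix_mul_assoc S_matrix_mult_S_matrix matrix_mult_distrib)
  next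
    assume "A ** S_matrix ** mcnj A = S_matrix"
    then have "S_matrix ** (A ** S_matrix ** mcnj A) = - mat 1" by (simp add: S_matrix_mult_S_matrix)
    then show "S_matrix ** A ** S_matrix ** mcnj A = - mat 1" by (simp add: matrix_mul_assoc)
  qed
  also have "\<dots> \<longleftrightarrow> mcnj (A ** S_matrix ** mcnj A) = mcnj S_matrix"
    by (metis mcnj_simps(1))
  also have "\<dots> \<longleftrightarrow> transpose A ** S_matrix ** A = S_matrix"
    unfolding mcnj_simps mcnj_S_matrix unfolding mcnj_hermitian[OF assms] ..
  finally show ?thesis .
qed

lemma inv_flat_eqI: "inj (flat \<omega>) \<Longrightarrow> flat \<omega> y = x \<Longrightarrow> inv (flat \<omega>) x = y"
  by (metis inv_f_f)

lemma complexify_square: "complexify T \<circ> complexify T = uminus \<longleftrightarrow> (\<forall>x. T (T x) = - x)"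
proof
  assume eq: "complexify T \<circ> complexify T = uminus"
  show "\<forall>x. T (T x) = - x"
  proof
    fix x show "T (T x) = - x" using fun_cong[OF eq, of "(x, x)"] by (simp add: complexify_def)
  qed
qed (simp add: complexify_def fun_eq_iff)

text \<open>
  The condition on \<open>J\<close> follows from the one on \<open>K\<close>: if $K^2 = -1$, then
  $\omega_I(KIx, \cdot) = \omega_J(K^2Ix, \cdot) = -\omega_J(Ix, \cdot) = \omega_K(x, \cdot)$, so $J = KI$, and
  $J^2 = -1$ because \<open>K\<close> is conjugate-linear.
\<close>

lemma quaternionic_iff_symplectic:
  fixes A :: "complex ^ ('n + 'n) ^ ('n::finite + 'n)"
  assumes herm: "conj_transpose A = A" and \<omega>: "\<And>u v. \<omega> u v = - Im (hermitian_pairing A u v)"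
    and pos: "\<And>v. v \<noteq> 0 \<Longrightarrow> \<omega> v (I_struct v) > 0"
  defines "J \<equiv> inv (flat \<omega>) \<circ> flat omega_K" and "K \<equiv> inv (flat omega_J) \<circ> flat \<omega>"
  shows "(complexify J \<circ> complexify J = uminus \<and> complexify K \<circ> complexify K = uminus) \<longleftrightarrow>
    transpose A ** S_matrix ** A = S_matrix"
proof -
  have flat_K: "flat omega_J (K_map A x) = flat \<omega> x" for x
    by (simp add: flat_def omega_J_K_map[OF herm] \<omega>)
  have inj: "inj (flat \<omega>)"
  proof (rule injI)
    fix x y assume "flat \<omega> x = flat \<omega> y"
    then have "\<omega> x v = \<omega> y v" for v by (metis flat_def)
    then have "\<omega> (x - y) v = 0" for v by (simp add: \<omega> hermitian_pairing_diff)
    then show "x = y" using pos[of "x - y"] by auto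
  qed
  have K: "K = K_map A"
    unfolding K_def using inv_flat_eqI[OF inj_flat_omega_J flat_K] by (simp add: fun_eq_iff)
  have "J (J x) = - x" if sq: "\<forall>u. K_map A (K_map A u) = - u" for x
  proof -
    have "flat \<omega> (K_map A (I_struct x)) = flat omega_K x" for x
      unfolding flat_K[symmetric] by (simp add: flat_def sq omega_J_minus omega_J_I_struct)
    then have "J = (\<lambda>x. K_map A (I_struct x))"
      unfolding J_def using inv_flat_eqI[OF inj] by (simp add: fun_eq_iff)
    then show ?thesis using sq by (simp add: I_struct_def K_map_scale K_map_minus)
  qed
  then show ?thesis unfolding complexify_square K K_map_square_iff[OF herm, symmetric] by blast
qed

theorem proposition4p4:
  fixes \<sigma> :: "'n::{finite,linorder} option \<Rightarrow> 'n mat1"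
    and s :: complex
    and f :: "real \<Rightarrow> real"
  assumes sigma: "admissible_sigma \<sigma>"
    and s: "s \<noteq> 0"
    and smooth: "smooth_real f"
    and positive: "\<And>\<alpha> P v. P \<in> chart_domain \<sigma> s \<alpha> \<Longrightarrow> v \<noteq> 0 \<Longrightarrow>
                     omega_I \<sigma> s f \<alpha> (coords \<alpha> P) v (I_struct v) > 0"
  shows "\<forall>\<alpha>. \<forall>P \<in> chart_domain \<sigma> s \<alpha>.
    let p = coords \<alpha> P;
        J = complexify (J_endo \<sigma> s f \<alpha> p);
        K = complexify (K_endo \<sigma> s f \<alpha> p);
        A = A_matrix \<sigma> s f \<alpha> p
    in (J \<circ> J = uminus \<and> K \<circ> K = uminus) \<longleftrightarrow> transpose A ** S_matrix ** A = S_matrix"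
proof (intro allI ballI)
  fix \<alpha> P assume P: "P \<in> chart_domain \<sigma> s \<alpha>"
  let ?p = "coords \<alpha> P"
  have f: "f field_differentiable (at x)" for x
    using smooth[unfolded smooth_real_def, rule_format, of 0 x] by simp
  note form = ddc_form_one_one[OF f real_polynomial_tau_loc[OF sigma s, of \<alpha>], folded omega_I_def]
  obtain g where g: "conj_transpose g = g"
      "\<And>u v. omega_I \<sigma> s f \<alpha> ?p u v = - Im (hermitian_pairing g u v)"
    using one_one_form_components[OF form(1,2,3)] by metis
  have "A_matrix \<sigma> s f \<alpha> ?p = g"
    unfolding A_matrix_def by (rule the_components[OF g])
  then show "let p = coords \<alpha> P;
        J = complexify (J_endo \<sigma> s f \<alpha> p);
        K = complexify (K_endo \<sigma> s f \<alpha> p);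
        A = A_matrix \<sigma> s f \<alpha> p
    in (J \<circ> J = uminus \<and> K \<circ> K = uminus) \<longleftrightarrow> transpose A ** S_matrix ** A = S_matrix"
    unfolding Let_def J_endo_def K_endo_def
    using quaternionic_iff_symplectic[OF g positive[OF P]] by simp
qed

end
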